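(* Let $K$ be a continuous translation-invariant symmetric (strictly) positive definite Fourier-transformable kernel on $\mathbb R^d$ with enough decay at infinity (in particular $\int_\Omega K(x-y)^2\,dy<\infty$ for all $x\in\mathbb R^d$), and let $\Omega\subset\mathbb R^d$ be a bounded domain. Then the localized spaces $\mathcal H_K(\Omega)$ and $\mathcal H(\Omega,K_\kappa)$ can be identified (isometrically, via the eigenfunction extension $f\mapsto f^E$ from $\mathcal H(\Omega,K_\kappa)$ to $\mathcal H_K(\Omega)$, with restriction to $\Omega$ as inverse), and the extensions to $\mathbb R^d$ via eigenfunctions and by norm-minimality coincide: for $f\in\mathcal H(\Omega,K_\kappa)$, $f^E$ is the unique extension of $f$ to $\mathbb R^d$ of minimal $\mathcal H_K$-norm. Working with a Mercer expansion on $\Omega$ means working in the space $\mathcal H_K(\Omega)$, which shows superconvergence if $\mathcal H_{K*K}$-smoothness is added, i.e. superconvergence occurs for $f\in\mathcal H_K(\Omega)\cap\mathcal H_{K*K}$.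
   Context: $\mathcal H_K$ is the reproducing kernel Hilbert space on $\mathbb R^d$ with kernel $K(x-y)$ and inner product $(\cdot,\cdot)_K$. $\mathcal H_K(\Omega)$, with the inner product of $\mathcal H_K$, is the orthogonal complement in $\mathcal H_K$ of $\{f\in\mathcal H_K: f=0\text{ on }\Omega\}$; equivalently, the $\mathcal H_K$-closure of the span of the kernel translates $K(\cdot-x)$, $x\in\Omega$. $\mathcal H_{K*K}$ is the space of all $f=K*v_f$ with $v_f\in L_2(\mathbb R^d)$. The Mercer expansion of $K$ on $\Omega$ is $K(x-y)=\sum_{n=0}^\infty\kappa_n\varphi_n(x)\varphi_n(y)=:K_\kappa(x,y)$ for $x,y\in\Omega$, with functions $\varphi_n$ forming a complete orthonormal system in $L_2(\Omega)$ and eigenvalues $\kappa_n>0$ satisfying $\kappa_n\varphi_n(x)=\int_\Omega K(x-y)\varphi_n(y)\,dy$ for $x\in\Omega$. The space $\mathcal H(\Omega,K_\kappa)$ is the native Hilbert space of $K_\kappa$, consisting of the functions $f(x)=\sum_{n=0}^\infty(f,\varphi_n)_{L_2(\Omega)}\varphi_n(x)$, $x\in\Omega$, with finite norm for the inner product $$(f,g)_{\Omega,K_\kappa}=\sum_{n=0}^\infty\frac{(f,\varphi_n)_{L_2(\Omega)}(g,\varphi_n)_{L_2(\Omega)}}{\kappa_n}.$$ The eigensystem extensions are $\varphi_n^E(x):=\kappa_n^{-1}\int_\Omega K(x-y)\varphi_n(y)\,dy$, $x\in\mathbb R^d$, and the eigenfunction extension of $f\in\mathcal H(\Omega,K_\kappa)$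 is $f^E(x):=\sum_{n=0}^\infty(f,\varphi_n)_{L_2(\Omega)}\varphi_n^E(x)$, $x\in\mathbb R^d$. Superconvergence for $f$ means: whenever $\Pi_K$ is a best-approximation (orthogonal) projector of $\mathcal H_K$ onto a closed subspace of $\mathcal H_K(\Omega)$ with a standard error bound $\|g-\Pi_Kg\|_{L_2(\Omega)}\le\epsilon\|g-\Pi_Kg\|_K$ for all $g\in\mathcal H_K$, one has $\|f-\Pi_Kf\|_{L_2(\Omega)}\le\epsilon^2\|v_f\|_{L_2(\mathbb R^d)}$.
   Formalization: Superconvergence is stated only if the functions of H_K vanishing on Ω are dense in L_2(R^d∖Ω); without this it fails, e.g. for K(x)=exp(-x²), Ω a short interval, projector 0 and f=K*K. "Fourier-transformable with enough decay" is read as K integrable. *)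

theory Defs
  imports "HOL-Analysis.Analysis"
begin

definition strictly_positive_definite :: "('a::euclidean_space \<Rightarrow> real) \<Rightarrow> bool" where
  "strictly_positive_definite K \<longleftrightarrow>
     (\<forall>X a. finite X \<and> (\<exists>x\<in>X. a x \<noteq> 0) \<longrightarrow>
        (\<Sum>x\<in>X. \<Sum>y\<in>X. a x * a y * K (x - y)) > 0)"

definition L2_on :: "'a::euclidean_space set \<Rightarrow> ('a \<Rightarrow> real) \<Rightarrow> bool" where
  "L2_on \<Omega> f \<longleftrightarrow> set_borel_measurable lborel \<Omega> f \<and> set_integrable lborel \<Omega> (\<lambda>x. (f x)\<^sup>2)"

definition L2_inner :: "'a::euclidean_space set \<Rightarrow> ('a \<Rightarrow> real) \<Rightarrow> ('a \<Rightarrow> real) \<Rightarrow> real" where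
  "L2_inner \<Omega> f g = (LINT x:\<Omega>|lborel. f x * g x)"

definition L2_norm :: "'a::euclidean_space set \<Rightarrow> ('a \<Rightarrow> real) \<Rightarrow> real" where
  "L2_norm \<Omega> f = sqrt (L2_inner \<Omega> f f)"

definition linear_subspace :: "('a \<Rightarrow> real) set \<Rightarrow> bool" where
  "linear_subspace V \<longleftrightarrow> (\<lambda>x. 0) \<in> V \<and>
     (\<forall>f\<in>V. \<forall>g\<in>V. \<forall>a b. (\<lambda>x. a * f x + b * g x) \<in> V)"

definition ip_norm :: "(('a \<Rightarrow> real) \<Rightarrow> ('a \<Rightarrow> real) \<Rightarrow> real) \<Rightarrow> ('a \<Rightarrow> real) \<Rightarrow> real" where
  "ip_norm ip f = sqrt (ip f f)"

(* Only the values of ip on H are relevant. *)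
locale function_hilbert_space =
  fixes H :: "('a \<Rightarrow> real) set"
    and ip :: "('a \<Rightarrow> real) \<Rightarrow> ('a \<Rightarrow> real) \<Rightarrow> real"
  assumes subspace: "linear_subspace H"
    and ip_sym: "\<lbrakk>f \<in> H; g \<in> H\<rbrakk> \<Longrightarrow> ip f g = ip g f"
    and ip_linear: "\<lbrakk>f \<in> H; g \<in> H; h \<in> H\<rbrakk> \<Longrightarrow>
          ip (\<lambda>x. a * f x + b * g x) h = a * ip f h + b * ip g h"
    and ip_pos: "\<lbrakk>f \<in> H; f \<noteq> (\<lambda>x. 0)\<rbrakk> \<Longrightarrow> ip f f > 0"
    and complete: "\<lbrakk>\<And>n. s n \<in> H;
          \<And>e. e > 0 \<Longrightarrow> \<exists>N. \<forall>m\<ge>N. \<forall>n\<ge>N. ip_norm ip (\<lambda>x. s m x - s n x) < e\<rbrakk> \<Longrightarrow>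
          \<exists>f\<in>H. (\<lambda>n. ip_norm ip (\<lambda>x. s n x - f x)) \<longlonglongrightarrow> 0"

(* The pair of H and of the restriction of ip to H is determined by the kernel k. *)
locale rkhs = function_hilbert_space H ip
  for H :: "('a \<Rightarrow> real) set" and ip +
  fixes k :: "'a \<Rightarrow> 'a \<Rightarrow> real"
  assumes kernel_mem: "(\<lambda>y. k y x) \<in> H"
    and reproducing: "f \<in> H \<Longrightarrow> f x = ip f (\<lambda>y. k y x)"

definition vanishing_on :: "('a \<Rightarrow> real) set \<Rightarrow> 'a set \<Rightarrow> ('a \<Rightarrow> real) set" where
  "vanishing_on H \<Omega> = {g \<in> H. \<forall>x\<in>\<Omega>. g x = 0}"

definition localized_space ::
  "('a \<Rightarrow> real) set \<Rightarrow> (('a \<Rightarrow> real) \<Rightarrow> ('a \<Rightarrow> real) \<Rightarrow> real) \<Rightarrow> 'a set \<Rightarrow> ('a \<Rightarrow> real) set" where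
  "localized_space H ip \<Omega> = {f \<in> H. \<forall>g\<in>vanishing_on H \<Omega>. ip f g = 0}"

definition complete_orthonormal_system ::
  "'a::euclidean_space set \<Rightarrow> (nat \<Rightarrow> 'a \<Rightarrow> real) \<Rightarrow> bool" where
  "complete_orthonormal_system \<Omega> \<phi> \<longleftrightarrow>
     (\<forall>n. L2_on \<Omega> (\<phi> n)) \<and>
     (\<forall>m n. L2_inner \<Omega> (\<phi> m) (\<phi> n) = (if m = n then 1 else 0)) \<and>
     (\<forall>f. L2_on \<Omega> f \<and> (\<forall>n. L2_inner \<Omega> f (\<phi> n) = 0) \<longrightarrow>
          (AE x in lborel. x \<in> \<Omega> \<longrightarrow> f x = 0))"

definition mercer_expansion ::
  "('a::euclidean_space \<Rightarrow> real) \<Rightarrow> 'a set \<Rightarrow> (nat \<Rightarrow> real) \<Rightarrow> (nat \<Rightarrow> 'a \<Rightarrow> real) \<Rightarrow> bool" where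
  "mercer_expansion K \<Omega> \<kappa> \<phi> \<longleftrightarrow>
     complete_orthonormal_system \<Omega> \<phi> \<and>
     (\<forall>n. \<kappa> n > 0) \<and>
     (\<forall>n. \<forall>x\<in>\<Omega>. \<kappa> n * \<phi> n x = (LINT y:\<Omega>|lborel. K (x - y) * \<phi> n y)) \<and>
     (\<forall>x\<in>\<Omega>. \<forall>y\<in>\<Omega>. (\<lambda>n. \<kappa> n * \<phi> n x * \<phi> n y) sums K (x - y))"

(* Functions on \<Omega> are represented by functions that are undefined outside \<Omega>. *)
definition native_space ::
  "'a::euclidean_space set \<Rightarrow> (nat \<Rightarrow> real) \<Rightarrow> (nat \<Rightarrow> 'a \<Rightarrow> real) \<Rightarrow> ('a \<Rightarrow> real) set" where
  "native_space \<Omega> \<kappa> \<phi> = {f \<in> extensional \<Omega>. L2_on \<Omega> f \<and>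
     (\<forall>x\<in>\<Omega>. (\<lambda>n. L2_inner \<Omega> f (\<phi> n) * \<phi> n x) sums f x) \<and>
     summable (\<lambda>n. (L2_inner \<Omega> f (\<phi> n))\<^sup>2 / \<kappa> n)}"

definition native_ip ::
  "'a::euclidean_space set \<Rightarrow> (nat \<Rightarrow> real) \<Rightarrow> (nat \<Rightarrow> 'a \<Rightarrow> real) \<Rightarrow>
   ('a \<Rightarrow> real) \<Rightarrow> ('a \<Rightarrow> real) \<Rightarrow> real" where
  "native_ip \<Omega> \<kappa> \<phi> f g = (\<Sum>n. L2_inner \<Omega> f (\<phi> n) * L2_inner \<Omega> g (\<phi> n) / \<kappa> n)"

definition eigensystem_ext ::
  "('a::euclidean_space \<Rightarrow> real) \<Rightarrow> 'a set \<Rightarrow> (nat \<Rightarrow> real) \<Rightarrow> (nat \<Rightarrow> 'a \<Rightarrow> real) \<Rightarrow>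
   nat \<Rightarrow> 'a \<Rightarrow> real" where
  "eigensystem_ext K \<Omega> \<kappa> \<phi> n x = inverse (\<kappa> n) * (LINT y:\<Omega>|lborel. K (x - y) * \<phi> n y)"

definition eigenfunction_ext ::
  "('a::euclidean_space \<Rightarrow> real) \<Rightarrow> 'a set \<Rightarrow> (nat \<Rightarrow> real) \<Rightarrow> (nat \<Rightarrow> 'a \<Rightarrow> real) \<Rightarrow>
   ('a \<Rightarrow> real) \<Rightarrow> 'a \<Rightarrow> real" where
  "eigenfunction_ext K \<Omega> \<kappa> \<phi> f x =
     (\<Sum>n. L2_inner \<Omega> f (\<phi> n) * eigensystem_ext K \<Omega> \<kappa> \<phi> n x)"

definition convolution :: "('a::euclidean_space \<Rightarrow> real) \<Rightarrow> ('a \<Rightarrow> real) \<Rightarrow> 'a \<Rightarrow> real" where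
  "convolution K v x = (LINT y|lborel. K (x - y) * v y)"

definition conv_smooth_space :: "('a::euclidean_space \<Rightarrow> real) \<Rightarrow> ('a \<Rightarrow> real) set" where
  "conv_smooth_space K = {convolution K v | v. L2_on UNIV v}"

definition closed_subspace ::
  "('a \<Rightarrow> real) set \<Rightarrow> (('a \<Rightarrow> real) \<Rightarrow> ('a \<Rightarrow> real) \<Rightarrow> real) \<Rightarrow> ('a \<Rightarrow> real) set \<Rightarrow> bool" where
  "closed_subspace H ip V \<longleftrightarrow> V \<subseteq> H \<and> linear_subspace V \<and>
     (\<forall>s f. (\<forall>n. s n \<in> V) \<and> f \<in> H \<and> (\<lambda>n. ip_norm ip (\<lambda>x. s n x - f x)) \<longlonglongrightarrow> 0 \<longrightarrow> f \<in> V)"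

definition orthogonal_projector ::
  "('a \<Rightarrow> real) set \<Rightarrow> (('a \<Rightarrow> real) \<Rightarrow> ('a \<Rightarrow> real) \<Rightarrow> real) \<Rightarrow> ('a \<Rightarrow> real) set \<Rightarrow>
   (('a \<Rightarrow> real) \<Rightarrow> 'a \<Rightarrow> real) \<Rightarrow> bool" where
  "orthogonal_projector H ip V P \<longleftrightarrow>
     (\<forall>g\<in>H. P g \<in> V \<and> (\<forall>w\<in>V. ip (\<lambda>x. g x - P g x) w = 0))"

(* If the Fourier transform of K vanishes on a non-null set, f = K * v does not determine v;
   the bound is then required for every such v. *)
definition superconvergent ::
  "('a::euclidean_space \<Rightarrow> real) \<Rightarrow> ('a \<Rightarrow> real) set \<Rightarrow>
   (('a \<Rightarrow> real) \<Rightarrow> ('a \<Rightarrow> real) \<Rightarrow> real) \<Rightarrow> 'a set \<Rightarrow> ('a \<Rightarrow> real) \<Rightarrow> bool" where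
  "superconvergent K H ip \<Omega> f \<longleftrightarrow>
     (\<forall>V P \<epsilon> v.
        closed_subspace H ip V \<and> V \<subseteq> localized_space H ip \<Omega> \<and>
        orthogonal_projector H ip V P \<and>
        (\<forall>g\<in>H. L2_norm \<Omega> (\<lambda>x. g x - P g x) \<le> \<epsilon> * ip_norm ip (\<lambda>x. g x - P g x)) \<and>
        L2_on UNIV v \<and> f = convolution K v \<longrightarrow>
        L2_norm \<Omega> (\<lambda>x. f x - P f x) \<le> \<epsilon>\<^sup>2 * L2_norm UNIV v)"

(* The functions of H that vanish on \<Omega> are dense in L2 of the complement of \<Omega>.  For f = K * v
   in the localized space, this is what forces v to vanish a.e. outside \<Omega>.  It holds, e.g., if
   the boundary of \<Omega> is a null set and H contains all test functions (Sobolev kernels), but not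
   for kernels with analytic H: for K x = exp (- x^2) on the real line, \<Omega> = {-d<..<d},
   V = {0} and v = K, superconvergence fails for all small d > 0. *)
definition separates_complement :: "('a::euclidean_space \<Rightarrow> real) set \<Rightarrow> 'a set \<Rightarrow> bool" where
  "separates_complement H \<Omega> \<longleftrightarrow>
     (\<forall>h. L2_on UNIV h \<and> (\<forall>x\<in>\<Omega>. h x = 0) \<longrightarrow>
        (\<forall>e>0. \<exists>g\<in>vanishing_on H \<Omega>. L2_on UNIV g \<and> L2_norm UNIV (\<lambda>x. h x - g x) < e))"

end

theory Submission
  imports Defs
begin

text \<open>
  Everything rests on one adjointness relation. Since \<open>K\<close> is integrable, the native space \<open>H\<close> embeds
  continuously into \<open>L\<^sub>2\<close> of the whole space, and the adjoint of this embedding is convolution with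
  \<open>K\<close>: for every square integrable \<open>v\<close> the function \<open>K * v\<close> lies in \<open>H\<close>, and \<open>(K * v, g) = \<integral> v g\<close>
  for all \<open>g\<close> in \<open>H\<close> (\<open>mem_L2_bound\<close>, \<open>convolution_L2\<close>). The embedding is usually read off from the Fourier
  transform of \<open>K\<close>; here it is obtained from Schur's test and the Riesz representation theorem.

  Applied to an eigenfunction cut off outside \<open>\<Omega>\<close>, the relation says that the extension \<open>E n\<close> of \<open>\<phi> n\<close> lies
  in \<open>H\<close> and that \<open>(E n, g)\<close> is the Fourier coefficient of \<open>g\<close> on \<open>\<Omega>\<close>, divided by
  \<open>\<kappa> n\<close>. The \<open>E n\<close> are therefore orthogonal with square norms \<open>1 / \<kappa> n\<close>, and they are orthogonal to
  all functions that vanish on \<open>\<Omega>\<close>. Consequently the series that defines the eigenfunction extension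
  converges against every element of \<open>H\<close>, in particular pointwise, its sum is localized, and the inner product
  becomes that of the native space on \<open>\<Omega>\<close>. Conversely, a localized function and the extension of its
  restriction have the same Fourier coefficients; completeness of the eigenfunctions and continuity make
  their difference vanish on \<open>\<Omega>\<close>, and a localized function that vanishes on \<open>\<Omega>\<close> is zero
  (\<open>eigenfunction_ext_of_localized\<close>). Minimality of the norm is Pythagoras' theorem.

  For superconvergence, adjointness turns the localization of \<open>f = K * v\<close> into \<open>\<integral> v g = 0\<close> for all \<open>g\<close>
  in \<open>H\<close> that vanish on \<open>\<Omega>\<close>. If these are dense in \<open>L\<^sub>2\<close> of the complement, \<open>v\<close> is concentrated on
  \<open>\<Omega>\<close>, and a duality argument squares the factor of the error bound
  (\<open>superconvergent_localized_convolution\<close>).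
\<close>

section \<open>Square integrable functions\<close>

text \<open>The discriminant argument behind the Cauchy--Schwarz inequality. It serves three times: for the
\<open>L\<^sub>2\<close> inner product, for the inner product of an abstract Hilbert space, and, with \<open>a = 0\<close>, as the
first-order optimality condition in the Riesz representation theorem.\<close>

lemma abs_le_sqrt_of_quadratic_nonneg:
  fixes a b c :: real
  assumes "\<And>t. 0 \<le> a + 2 * t * b + t\<^sup>2 * c"
  shows "\<bar>b\<bar> \<le> sqrt a * sqrt c"
proof -
  have a: "0 \<le> a" using assms[of 0] by simp
  have "b\<^sup>2 \<le> a * c"
  proof (cases "c = 0")
    case True
    have "b = 0"
    proof (rule ccontr)
      assume "b \<noteq> 0"
      then show False
        using assms[of "- (a + 1) / (2 * b)"] True a by (simp add: field_simps)
    qed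
    then show ?thesis using True by simp
  next
    case False
    have "0 < c"
    proof (rule ccontr)
      assume "\<not> 0 < c"
      then have "c < 0" using False by simp
      define t where "t = sqrt ((a + 1) / - c)"
      have "t\<^sup>2 = (a + 1) / - c"
        unfolding t_def using a \<open>c < 0\<close> by (simp add: divide_nonneg_neg)
      then have "t\<^sup>2 * c = - (a + 1)" using \<open>c < 0\<close> by (simp add: field_simps)
      then show False using assms[of t] assms[of "- t"] by simp
    qed
    have "0 \<le> a + 2 * (- b / c) * b + (- b / c)\<^sup>2 * c" by (rule assms)
    also have "\<dots> = a - b\<^sup>2 / c"
      using \<open>0 < c\<close> by (simp add: field_simps power2_eq_square)
    finally show ?thesis using \<open>0 < c\<close> by (simp add: field_simps)
  qed
  then have "sqrt (b\<^sup>2) \<le> sqrt (a * c)" by (rule real_sqrt_le_mono)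
  then show ?thesis by (simp add: real_sqrt_mult)
qed

lemma L2_on_UNIV: "L2_on UNIV f \<longleftrightarrow> f \<in> borel_measurable borel \<and> integrable lborel (\<lambda>x. (f x)\<^sup>2)"
  by (simp add: L2_on_def set_borel_measurable_def set_integrable_def)

lemma L2_on_zero_extension: "L2_on S f \<longleftrightarrow> L2_on UNIV (\<lambda>x. indicator S x * f x)"
proof -
  have "(\<lambda>x. (indicator S x * f x)\<^sup>2) = (\<lambda>x. indicator S x *\<^sub>R (f x)\<^sup>2)"
    by (auto simp: indicator_def)
  then show ?thesis
    by (simp add: L2_on_UNIV) (simp add: L2_on_def set_borel_measurable_def set_integrable_def)
qed

lemma L2_inner_UNIV: "L2_inner UNIV f g = (LINT x|lborel. f x * g x)"
  by (simp add: L2_inner_def set_lebesgue_integral_def)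

lemma L2_inner_zero_extension:
  "L2_inner S f g = L2_inner UNIV (\<lambda>x. indicator S x * f x) g"
  by (simp add: L2_inner_UNIV) (simp add: L2_inner_def set_lebesgue_integral_def mult.assoc)

lemma L2_inner_zero_extension_both:
  "L2_inner S f g = L2_inner UNIV (\<lambda>x. indicator S x * f x) (\<lambda>x. indicator S x * g x)"
  by (simp add: L2_inner_zero_extension[of S])
     (auto simp: L2_inner_UNIV indicator_def intro!: Bochner_Integration.integral_cong)

lemma L2_inner_sym: "L2_inner S f g = L2_inner S g f"
  by (simp add: L2_inner_def mult.commute)

lemma L2_inner_cong:
  assumes "\<And>x. x \<in> S \<Longrightarrow> f x = f' x" "\<And>x. x \<in> S \<Longrightarrow> g x = g' x"
  shows "L2_inner S f g = L2_inner S f' g'"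
  using assms
  by (auto simp: L2_inner_def set_lebesgue_integral_def indicator_def
      intro!: Bochner_Integration.integral_cong)

lemma L2_on_cong:
  assumes "\<And>x. x \<in> S \<Longrightarrow> f x = g x"
  shows "L2_on S f \<longleftrightarrow> L2_on S g"
proof -
  have "(\<lambda>x. indicator S x * f x) = (\<lambda>x. indicator S x * g x)"
    using assms by (auto simp: indicator_def)
  then show ?thesis by (simp add: L2_on_zero_extension[of S])
qed

lemma L2_integrable_mult:
  assumes f: "L2_on UNIV f" and g: "L2_on UNIV g"
  shows "integrable lborel (\<lambda>x. f x * g x)"
proof (rule Bochner_Integration.integrable_bound)
  show "integrable lborel (\<lambda>x. (f x)\<^sup>2 + (g x)\<^sup>2)"
    using f g by (simp add: L2_on_UNIV)
  show "(\<lambda>x. f x * g x) \<in> borel_measurable lborel"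
    using f g by (auto simp: L2_on_UNIV)
  show "AE x in lborel. norm (f x * g x) \<le> norm ((f x)\<^sup>2 + (g x)\<^sup>2)"
  proof (rule AE_I2)
    fix x
    have "2 * (\<bar>f x\<bar> * \<bar>g x\<bar>) \<le> (f x)\<^sup>2 + (g x)\<^sup>2"
      using sum_squares_bound[of "\<bar>f x\<bar>" "\<bar>g x\<bar>"] by simp
    moreover have "0 \<le> \<bar>f x\<bar> * \<bar>g x\<bar>" by simp
    ultimately have "\<bar>f x\<bar> * \<bar>g x\<bar> \<le> (f x)\<^sup>2 + (g x)\<^sup>2" by linarith
    then show "norm (f x * g x) \<le> norm ((f x)\<^sup>2 + (g x)\<^sup>2)"
      by (simp add: abs_mult)
  qed
qed

lemma L2_on_UNIV_lincomb:
  assumes f: "L2_on UNIV f" and g: "L2_on UNIV g"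
  shows "L2_on UNIV (\<lambda>x. a * f x + b * g x)"
proof -
  have "integrable lborel (\<lambda>x. a\<^sup>2 * (f x)\<^sup>2 + 2 * a * b * (f x * g x) + b\<^sup>2 * (g x)\<^sup>2)"
    using f g L2_integrable_mult[OF f g] by (simp add: L2_on_UNIV)
  also have "(\<lambda>x. a\<^sup>2 * (f x)\<^sup>2 + 2 * a * b * (f x * g x) + b\<^sup>2 * (g x)\<^sup>2)
      = (\<lambda>x. (a * f x + b * g x)\<^sup>2)"
    by (simp add: power2_eq_square algebra_simps)
  finally show ?thesis using f g by (auto simp: L2_on_UNIV)
qed

lemma L2_inner_UNIV_lincomb:
  assumes "L2_on UNIV f" "L2_on UNIV g" "L2_on UNIV h"
  shows "L2_inner UNIV (\<lambda>x. a * f x + b * g x) h = a * L2_inner UNIV f h + b * L2_inner UNIV g h"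
proof -
  have "(LINT x|lborel. (a * f x + b * g x) * h x)
      = (LINT x|lborel. a * (f x * h x) + b * (g x * h x))"
    by (simp add: algebra_simps)
  also have "\<dots> = a * (LINT x|lborel. f x * h x) + b * (LINT x|lborel. g x * h x)"
    using assms by (simp add: L2_integrable_mult)
  finally show ?thesis by (simp add: L2_inner_UNIV)
qed

lemma L2_inner_lincomb:
  assumes "L2_on S f" "L2_on S g" "L2_on S h"
  shows "L2_inner S (\<lambda>x. a * f x + b * g x) h = a * L2_inner S f h + b * L2_inner S g h"
  using L2_inner_UNIV_lincomb[OF assms[unfolded L2_on_zero_extension[of S]], of a b]
  by (simp add: L2_inner_zero_extension_both[of S] algebra_simps)

lemma L2_inner_self_nonneg: "0 \<le> L2_inner S f f"
  by (simp add: L2_inner_def set_lebesgue_integral_def)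

lemma L2_Cauchy_Schwarz:
  assumes f: "L2_on UNIV f" and g: "L2_on UNIV g"
  shows "\<bar>L2_inner UNIV f g\<bar> \<le> L2_norm UNIV f * L2_norm UNIV g"
  unfolding L2_norm_def
proof (rule abs_le_sqrt_of_quadratic_nonneg)
  fix t
  have tg: "L2_on UNIV (\<lambda>x. 1 * f x + t * g x)" using f g by (rule L2_on_UNIV_lincomb)
  have "0 \<le> L2_inner UNIV (\<lambda>x. 1 * f x + t * g x) (\<lambda>x. 1 * f x + t * g x)"
    by (rule L2_inner_self_nonneg)
  also have "\<dots> = 1 * L2_inner UNIV (\<lambda>x. 1 * f x + t * g x) f + t * L2_inner UNIV (\<lambda>x. 1 * f x + t * g x) g"
    by (subst L2_inner_sym, subst L2_inner_UNIV_lincomb[OF f g tg]) (simp add: L2_inner_sym)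
  also have "\<dots> = L2_inner UNIV f f + 2 * t * L2_inner UNIV f g + t\<^sup>2 * L2_inner UNIV g g"
    using L2_inner_UNIV_lincomb[OF f g f, of 1 t] L2_inner_UNIV_lincomb[OF f g g, of 1 t]
      L2_inner_sym[of UNIV g f]
    by (simp add: algebra_simps power2_eq_square)
  finally show "0 \<le> L2_inner UNIV f f + 2 * t * L2_inner UNIV f g + t\<^sup>2 * L2_inner UNIV g g" .
qed

lemma L2_on_UNIV_imp:
  assumes f: "L2_on UNIV f" and [measurable]: "S \<in> sets borel"
  shows "L2_on S f"
proof -
  have "integrable lborel (\<lambda>x. indicator S x *\<^sub>R (f x)\<^sup>2)"
    using f by (intro integrable_mult_indicator) (auto simp: L2_on_UNIV)
  moreover have "(\<lambda>x. indicator S x *\<^sub>R f x) \<in> borel_measurable borel"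
    using f by (auto simp: L2_on_UNIV intro!: borel_measurable_scaleR borel_measurable_indicator)
  ultimately show ?thesis
    by (simp add: L2_on_def set_borel_measurable_def set_integrable_def)
qed

lemma continuous_AE_zero_on_open:
  fixes f :: "'a::euclidean_space \<Rightarrow> real"
  assumes f: "continuous_on UNIV f" and S: "open S" and AE: "AE x in lborel. x \<in> S \<longrightarrow> f x = 0"
    and x: "x \<in> S"
  shows "f x = 0"
proof -
  let ?U = "S \<inter> {x. f x \<noteq> 0}"
  have "open {x. f x \<noteq> 0}"
    using open_vimage[OF open_Compl[OF closed_singleton] f, of 0] by (simp add: vimage_def)
  then have U: "open ?U" using S by blast
  have "?U \<in> null_sets lborel"
    using AE U by (subst (asm) AE_iff_null) (auto simp: Int_def)
  then have "negligible ?U"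
    by (simp add: negligible_iff_null_sets null_sets_completionI)
  then have "?U = {}" using open_not_negligible[OF U] by blast
  then show ?thesis using x by blast
qed

section \<open>Hilbert spaces of functions\<close>

context function_hilbert_space
begin

lemma lincomb_mem: "f \<in> H \<Longrightarrow> g \<in> H \<Longrightarrow> (\<lambda>x. a * f x + b * g x) \<in> H"
  using subspace by (auto simp: linear_subspace_def)

lemma zero_mem: "(\<lambda>x. 0) \<in> H"
  using subspace by (auto simp: linear_subspace_def)

lemma diff_mem: "f \<in> H \<Longrightarrow> g \<in> H \<Longrightarrow> (\<lambda>x. f x - g x) \<in> H"
  using lincomb_mem[of f g 1 "-1"] by simp

lemma scale_mem: "f \<in> H \<Longrightarrow> (\<lambda>x. a * f x) \<in> H"
  using lincomb_mem[of f f a 0] by simp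

lemma add_scaled_mem: "f \<in> H \<Longrightarrow> g \<in> H \<Longrightarrow> (\<lambda>x. f x + t * g x) \<in> H"
  using lincomb_mem[of f g 1 t] by simp

lemma ip_diff:
  "f \<in> H \<Longrightarrow> g \<in> H \<Longrightarrow> h \<in> H \<Longrightarrow> ip (\<lambda>x. f x - g x) h = ip f h - ip g h"
  using ip_linear[of f g h 1 "-1"] by simp

lemma ip_add_scaled:
  "f \<in> H \<Longrightarrow> g \<in> H \<Longrightarrow> h \<in> H \<Longrightarrow> ip (\<lambda>x. f x + t * g x) h = ip f h + t * ip g h"
  using ip_linear[of f g h 1 t] by simp

lemma ip_scale: "f \<in> H \<Longrightarrow> h \<in> H \<Longrightarrow> ip (\<lambda>x. a * f x) h = a * ip f h"
  using ip_linear[of f f h a 0] by simp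

lemma ip_zero_left: "h \<in> H \<Longrightarrow> ip (\<lambda>x. 0) h = 0"
  using ip_linear[of h h h 0 0] by simp

lemma ip_self_nonneg: "f \<in> H \<Longrightarrow> 0 \<le> ip f f"
  using ip_pos[of f] ip_zero_left[of f] by (cases "f = (\<lambda>x. 0)") auto

lemma ip_self_eq_0: "f \<in> H \<Longrightarrow> ip f f = 0 \<Longrightarrow> f = (\<lambda>x. 0)"
  using ip_pos[of f] by fastforce

lemma ip_norm_power2: "f \<in> H \<Longrightarrow> (ip_norm ip f)\<^sup>2 = ip f f"
  by (simp add: ip_norm_def ip_self_nonneg)

lemma ip_norm_nonneg: "f \<in> H \<Longrightarrow> 0 \<le> ip_norm ip f"
  by (simp add: ip_norm_def ip_self_nonneg)

lemma ip_add_scaled_self: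
  assumes f: "f \<in> H" and g: "g \<in> H"
  shows "ip (\<lambda>x. f x + t * g x) (\<lambda>x. f x + t * g x) = ip f f + 2 * t * ip f g + t\<^sup>2 * ip g g"
proof -
  have fg: "(\<lambda>x. f x + t * g x) \<in> H" using f g by (rule add_scaled_mem)
  have "ip (\<lambda>x. f x + t * g x) (\<lambda>x. f x + t * g x)
      = ip (\<lambda>x. f x + t * g x) f + t * ip (\<lambda>x. f x + t * g x) g"
    by (simp add: ip_add_scaled[OF f g fg] ip_sym[OF fg f] ip_sym[OF fg g])
  also have "\<dots> = ip f f + 2 * t * ip f g + t\<^sup>2 * ip g g"
    by (simp add: ip_add_scaled[OF f g f] ip_add_scaled[OF f g g] ip_sym[OF g f]
        algebra_simps power2_eq_square)
  finally show ?thesis .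
qed

lemma ip_diff_self:
  assumes "f \<in> H" "g \<in> H"
  shows "ip (\<lambda>x. f x - g x) (\<lambda>x. f x - g x) = ip f f - 2 * ip f g + ip g g"
  using ip_add_scaled_self[OF assms, of "-1"] by simp

lemma Cauchy_Schwarz:
  assumes f: "f \<in> H" and g: "g \<in> H"
  shows "\<bar>ip f g\<bar> \<le> ip_norm ip f * ip_norm ip g"
  unfolding ip_norm_def
proof (rule abs_le_sqrt_of_quadratic_nonneg)
  fix t
  show "0 \<le> ip f f + 2 * t * ip f g + t\<^sup>2 * ip g g"
    using ip_self_nonneg[OF add_scaled_mem[OF f g]] ip_add_scaled_self[OF f g] by simp
qed

lemma ip_tendsto:
  assumes s: "\<And>n. s n \<in> H" and u: "u \<in> H" and g: "g \<in> H"
    and lim: "(\<lambda>n. ip_norm ip (\<lambda>x. s n x - u x)) \<longlonglongrightarrow> 0"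
  shows "(\<lambda>n. ip (s n) g) \<longlonglongrightarrow> ip u g"
proof -
  have "(\<lambda>n. ip (s n) g - ip u g) \<longlonglongrightarrow> 0"
  proof (rule Lim_null_comparison)
    show "\<forall>\<^sub>F n in sequentially. norm (ip (s n) g - ip u g)
        \<le> ip_norm ip (\<lambda>x. s n x - u x) * ip_norm ip g"
      using Cauchy_Schwarz[OF diff_mem[OF s u] g] by (simp add: ip_diff[OF s u g])
    show "(\<lambda>n. ip_norm ip (\<lambda>x. s n x - u x) * ip_norm ip g) \<longlonglongrightarrow> 0"
      using tendsto_mult_right[OF lim, of "ip_norm ip g"] by simp
  qed
  then show ?thesis by (simp add: LIM_zero_iff)
qed

text \<open>The representer of \<open>L\<close> is the minimizer of the energy \<open>J f = (f, f) - 2 L f\<close>. The parallelogram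
identity bounds the squared distance of two points by their excess energy, so that minimizing
sequences are Cauchy sequences, and the vanishing of the first variation at the limit is the
representation identity.\<close>

lemma Riesz_representation:
  assumes lin: "\<And>f g a b. f \<in> H \<Longrightarrow> g \<in> H \<Longrightarrow> L (\<lambda>x. a * f x + b * g x) = a * L f + b * L g"
    and bd: "\<And>f. f \<in> H \<Longrightarrow> \<bar>L f\<bar> \<le> C * ip_norm ip f"
  shows "\<exists>u\<in>H. \<forall>f\<in>H. ip u f = L f"
proof -
  define J where "J f = ip f f - 2 * L f" for f
  define m where "m = Inf (J ` H)"
  have J_bd: "- C\<^sup>2 \<le> J f" if f: "f \<in> H" for f
  proof -
    have "0 \<le> (ip_norm ip f - C)\<^sup>2" by simp
    then have "2 * (C * ip_norm ip f) \<le> ip f f + C\<^sup>2"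
      using ip_norm_power2[OF f] by (simp add: power2_diff algebra_simps)
    then show ?thesis using bd[OF f] by (auto simp: J_def abs_le_iff)
  qed
  have bdd: "bdd_below (J ` H)" by (rule bdd_belowI2[of _ "- C\<^sup>2"]) (rule J_bd)
  have m_le: "m \<le> J f" if "f \<in> H" for f
    unfolding m_def by (rule cINF_lower[OF bdd that])
  have "\<exists>f\<in>H. J f < m + inverse (real (Suc n))" for n
  proof -
    have "Inf (J ` H) < m + inverse (real (Suc n))" by (simp add: m_def)
    then show ?thesis
      using cInf_lessD[of "J ` H"] zero_mem by blast
  qed
  then obtain s where s: "\<And>n. s n \<in> H" and Js: "\<And>n. J (s n) < m + inverse (real (Suc n))"
    by metis
  have J_add: "J (\<lambda>x. f x + t * g x) = J f + 2 * t * (ip f g - L g) + t\<^sup>2 * ip g g"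
    if "f \<in> H" "g \<in> H" for f g t
    using ip_add_scaled_self[OF that, of t] lin[OF that, of 1 t] by (simp add: J_def algebra_simps)
  \<comment> \<open>The energy at the midpoint of \<open>f\<close> and \<open>g\<close> is at least the infimum.\<close>
  have dist: "ip (\<lambda>x. f x - g x) (\<lambda>x. f x - g x) \<le> 2 * (J f - m) + 2 * (J g - m)"
    if f: "f \<in> H" and g: "g \<in> H" for f g
  proof -
    have d: "(\<lambda>x. f x - g x) \<in> H" using f g by (rule diff_mem)
    define d where "d = (\<lambda>x. f x - g x)"
    have dH: "d \<in> H" using d by (simp add: d_def)
    have "f = (\<lambda>x. g x + 1 * d x)" by (simp add: d_def)
    then have "J f = J g + 2 * (ip g d - L d) + ip d d"
      using J_add[OF g dH, of 1] by simp
    moreover have "m \<le> J g + (ip g d - L d) + ip d d / 4"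
      using m_le[OF add_scaled_mem[OF g dH, of "1/2"]] J_add[OF g dH, of "1/2"]
      by (simp add: power2_eq_square)
    ultimately show ?thesis by (simp add: d_def[symmetric])
  qed
  have "\<exists>u\<in>H. (\<lambda>n. ip_norm ip (\<lambda>x. s n x - u x)) \<longlonglongrightarrow> 0"
  proof (rule complete[OF s])
    fix e :: real assume e: "0 < e"
    obtain N where N: "inverse (real (Suc N)) < e\<^sup>2 / 4"
      using reals_Archimedean[of "e\<^sup>2 / 4"] e by auto
    have "ip_norm ip (\<lambda>x. s i x - s j x) < e" if "N \<le> i" "N \<le> j" for i j
    proof -
      have "J (s k) - m < e\<^sup>2 / 4" if "N \<le> k" for k
      proof -
        have "inverse (real (Suc k)) \<le> inverse (real (Suc N))"
          using that by (intro le_imp_inverse_le) auto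
        then show ?thesis using Js[of k] N by linarith
      qed
      from this[OF that(1)] this[OF that(2)]
      have "ip (\<lambda>x. s i x - s j x) (\<lambda>x. s i x - s j x) < e\<^sup>2"
        using dist[OF s s, of i j] by simp
      then have "sqrt (ip (\<lambda>x. s i x - s j x) (\<lambda>x. s i x - s j x)) < sqrt (e\<^sup>2)"
        by (rule real_sqrt_less_mono)
      then show ?thesis using e by (simp add: ip_norm_def)
    qed
    then show "\<exists>N. \<forall>i\<ge>N. \<forall>j\<ge>N. ip_norm ip (\<lambda>x. s i x - s j x) < e" by blast
  qed
  then obtain u where u: "u \<in> H" and lim: "(\<lambda>n. ip_norm ip (\<lambda>x. s n x - u x)) \<longlonglongrightarrow> 0"
    by blast
  have "ip u h = L h" if h: "h \<in> H" for h
  proof -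
    \<comment> \<open>The variation of the energy in direction \<open>h\<close>, passed to the limit: the constant term tends
      to \<open>0\<close> along the minimizing sequence, which forces the linear term to vanish.\<close>
    have "\<bar>ip u h - L h\<bar> \<le> sqrt 0 * sqrt (ip h h)"
    proof (rule abs_le_sqrt_of_quadratic_nonneg)
      fix t
      have "(\<lambda>n. inverse (real (Suc n)) + 2 * t * (ip (s n) h - L h) + t\<^sup>2 * ip h h)
          \<longlonglongrightarrow> 0 + 2 * t * (ip u h - L h) + t\<^sup>2 * ip h h"
        by (intro tendsto_intros LIMSEQ_inverse_real_of_nat ip_tendsto[OF s u h lim])
      moreover have "0 \<le> inverse (real (Suc n)) + 2 * t * (ip (s n) h - L h) + t\<^sup>2 * ip h h" for n
        using m_le[OF add_scaled_mem[OF s h, of n t]] Js[of n] J_add[OF s h, of n t] by simp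
      ultimately show "0 \<le> 0 + 2 * t * (ip u h - L h) + t\<^sup>2 * ip h h"
        using LIMSEQ_le_const by blast
    qed
    then show ?thesis by simp
  qed
  then show ?thesis using u by blast
qed

lemma finite_lincomb_mem:
  fixes e :: "nat \<Rightarrow> 'a \<Rightarrow> real"
  assumes "\<And>n. e n \<in> H"
  shows "(\<lambda>x. \<Sum>n<N. c n * e n x) \<in> H"
proof (induction N)
  case 0
  show ?case by (simp add: zero_mem)
next
  case (Suc N)
  then show ?case using add_scaled_mem[OF Suc assms, of "c N" N] by simp
qed

lemma ip_finite_lincomb:
  fixes e :: "nat \<Rightarrow> 'a \<Rightarrow> real"
  assumes e: "\<And>n. e n \<in> H" and g: "g \<in> H"
  shows "ip (\<lambda>x. \<Sum>n<N. c n * e n x) g = (\<Sum>n<N. c n * ip (e n) g)"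
proof (induction N)
  case 0
  show ?case by (simp add: ip_zero_left g)
next
  case (Suc N)
  then show ?case using ip_add_scaled[OF finite_lincomb_mem[of e c N, OF e] e g] by simp
qed

lemma ip_finite_lincomb_self:
  fixes e :: "nat \<Rightarrow> 'a \<Rightarrow> real" and \<kappa> :: "nat \<Rightarrow> real"
  assumes e: "\<And>n. e n \<in> H" and orth: "\<And>m n. ip (e m) (e n) = (if m = n then 1 / \<kappa> n else 0)"
  shows "ip (\<lambda>x. \<Sum>n<N. c n * e n x) (\<lambda>x. \<Sum>n<N. c n * e n x) = (\<Sum>n<N. (c n)\<^sup>2 / \<kappa> n)"
proof -
  let ?s = "\<lambda>x. \<Sum>n<N. c n * e n x"
  have s: "?s \<in> H" using e by (rule finite_lincomb_mem)
  have "ip (e n) ?s = c n / \<kappa> n" if "n < N" for n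
  proof -
    have "ip (e n) ?s = (\<Sum>m<N. c m * ip (e m) (e n))"
      by (simp add: ip_sym[OF e s] ip_finite_lincomb[OF e e])
    also have "\<dots> = c n / \<kappa> n"
      using that by (simp add: orth if_distrib sum.delta cong: if_cong)
    finally show ?thesis .
  qed
  then show ?thesis
    by (simp add: ip_finite_lincomb[OF e s] power2_eq_square)
qed

text \<open>The vectors \<open>sqrt (\<kappa> n) e\<^sub>n\<close> are orthonormal; the partial sums are bounded by Bessel's
inequality. The scaling is the one in which Mercer eigenfunctions appear.\<close>

lemma Bessel:
  fixes e :: "nat \<Rightarrow> 'a \<Rightarrow> real" and \<kappa> :: "nat \<Rightarrow> real"
  assumes e: "\<And>n. e n \<in> H" and \<kappa>: "\<And>n. \<kappa> n > 0"
    and orth: "\<And>m n. ip (e m) (e n) = (if m = n then 1 / \<kappa> n else 0)" and g: "g \<in> H"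
  shows "summable (\<lambda>n. \<kappa> n * (ip (e n) g)\<^sup>2)"
proof (rule summableI_nonneg_bounded)
  show "0 \<le> \<kappa> n * (ip (e n) g)\<^sup>2" for n using \<kappa>[of n] by simp
  fix N
  let ?s = "\<lambda>x. \<Sum>n<N. (\<kappa> n * ip (e n) g) * e n x"
  have s: "?s \<in> H" by (rule finite_lincomb_mem) (rule e)
  have sg: "ip ?s g = (\<Sum>n<N. \<kappa> n * (ip (e n) g)\<^sup>2)"
    by (subst ip_finite_lincomb[OF e g]) (simp add: power2_eq_square mult.assoc)
  have ss: "ip ?s ?s = (\<Sum>n<N. \<kappa> n * (ip (e n) g)\<^sup>2)"
    unfolding ip_finite_lincomb_self[of e, OF e orth] using \<kappa>
    by (intro sum.cong) (auto simp: power2_eq_square less_imp_neq[symmetric])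
  have "0 \<le> ip g g - 2 * ip g ?s + ip ?s ?s"
    using ip_self_nonneg[OF diff_mem[OF g s]] ip_diff_self[OF g s] by simp
  then show "(\<Sum>n<N. \<kappa> n * (ip (e n) g)\<^sup>2) \<le> ip g g"
    by (simp add: ip_sym[OF g s] sg ss)
qed

text \<open>The functional \<open>g \<mapsto> \<Sum>n. c n * (e n, g)\<close> is well defined by Bessel's inequality and bounded by the
Cauchy--Schwarz inequality for the partial sums, so that the Riesz representation theorem yields the sum of
\<open>\<Sum>n. c n * e n\<close> in the weak sense. Weak convergence suffices for what follows: in a reproducing kernel
Hilbert space, testing with kernel translates turns it into pointwise convergence.\<close>

lemma orthogonal_series:
  fixes e :: "nat \<Rightarrow> 'a \<Rightarrow> real" and \<kappa> :: "nat \<Rightarrow> real"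
  assumes e: "\<And>n. e n \<in> H" and \<kappa>: "\<And>n. \<kappa> n > 0"
    and orth: "\<And>m n. ip (e m) (e n) = (if m = n then 1 / \<kappa> n else 0)"
    and c: "summable (\<lambda>n. (c n)\<^sup>2 / \<kappa> n)"
  shows "\<exists>F\<in>H. \<forall>g\<in>H. (\<lambda>n. c n * ip (e n) g) sums ip F g"
proof -
  define L where "L g = (\<Sum>n. c n * ip (e n) g)" for g
  have summ: "summable (\<lambda>n. c n * ip (e n) g)" if g: "g \<in> H" for g
  proof (rule summable_comparison_test)
    show "summable (\<lambda>n. (c n)\<^sup>2 / \<kappa> n + \<kappa> n * (ip (e n) g)\<^sup>2)"
      by (intro summable_add c Bessel[OF e \<kappa> orth g])
    have "\<bar>c n * ip (e n) g\<bar> \<le> (c n)\<^sup>2 / \<kappa> n + \<kappa> n * (ip (e n) g)\<^sup>2" for n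
    proof -
      let ?r = "sqrt (\<kappa> n)"
      have "2 * \<bar>c n / ?r\<bar> * \<bar>?r * ip (e n) g\<bar> \<le> \<bar>c n / ?r\<bar>\<^sup>2 + \<bar>?r * ip (e n) g\<bar>\<^sup>2"
        by (rule sum_squares_bound)
      moreover have "\<bar>c n / ?r\<bar> * \<bar>?r * ip (e n) g\<bar> = \<bar>c n * ip (e n) g\<bar>"
        using \<kappa>[of n] by (simp add: abs_mult)
      moreover have "\<bar>c n / ?r\<bar>\<^sup>2 + \<bar>?r * ip (e n) g\<bar>\<^sup>2 = (c n)\<^sup>2 / \<kappa> n + \<kappa> n * (ip (e n) g)\<^sup>2"
        using \<kappa>[of n] by (simp add: power_divide power_mult_distrib)
      ultimately show ?thesis by linarith
    qed
    then show "\<exists>N. \<forall>n\<ge>N. norm (c n * ip (e n) g) \<le> (c n)\<^sup>2 / \<kappa> n + \<kappa> n * (ip (e n) g)\<^sup>2"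
      by auto
  qed
  have "\<exists>F\<in>H. \<forall>g\<in>H. ip F g = L g"
  proof (rule Riesz_representation)
    fix f g a b assume f: "f \<in> H" and g: "g \<in> H"
    have "ip (e n) (\<lambda>x. a * f x + b * g x) = a * ip (e n) f + b * ip (e n) g" for n
      using ip_linear[OF f g e, of a b n] lincomb_mem[OF f g, of a b]
      by (simp add: ip_sym[OF e] f g)
    then have "L (\<lambda>x. a * f x + b * g x) = (\<Sum>n. a * (c n * ip (e n) f) + b * (c n * ip (e n) g))"
      by (simp add: L_def algebra_simps)
    also have "\<dots> = a * L f + b * L g"
      using summ[OF f] summ[OF g]
      by (simp add: L_def suminf_add[symmetric] suminf_mult summable_mult)
    finally show "L (\<lambda>x. a * f x + b * g x) = a * L f + b * L g" .
  next
    fix g assume g: "g \<in> H"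
    have "\<bar>\<Sum>n<N. c n * ip (e n) g\<bar> \<le> sqrt (\<Sum>n. (c n)\<^sup>2 / \<kappa> n) * ip_norm ip g" for N
    proof -
      let ?s = "\<lambda>x. \<Sum>n<N. c n * e n x"
      have s: "?s \<in> H" by (rule finite_lincomb_mem) (rule e)
      have "ip ?s ?s \<le> (\<Sum>n. (c n)\<^sup>2 / \<kappa> n)"
        unfolding ip_finite_lincomb_self[of e, OF e orth]
        using \<kappa> by (intro sum_le_suminf c) (auto simp: less_imp_le)
      then have "ip_norm ip ?s \<le> sqrt (\<Sum>n. (c n)\<^sup>2 / \<kappa> n)"
        unfolding ip_norm_def by (rule real_sqrt_le_mono)
      then show ?thesis
        using Cauchy_Schwarz[OF s g] mult_right_mono[OF _ ip_norm_nonneg[OF g]]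
        by (fastforce simp: ip_finite_lincomb[OF e g])
    qed
    moreover have "(\<lambda>N. \<bar>\<Sum>n<N. c n * ip (e n) g\<bar>) \<longlonglongrightarrow> \<bar>L g\<bar>"
      unfolding L_def by (intro tendsto_rabs summable_LIMSEQ summ g)
    ultimately show "\<bar>L g\<bar> \<le> sqrt (\<Sum>n. (c n)\<^sup>2 / \<kappa> n) * ip_norm ip g"
      using LIMSEQ_le_const2 by blast
  qed
  then show ?thesis
    using summ by (metis L_def summable_sums)
qed

end

section \<open>Convolution with a translation invariant reproducing kernel\<close>

lemma ennreal_abs_integral_le: "ennreal \<bar>integral\<^sup>L M f\<bar> \<le> (\<integral>\<^sup>+x. ennreal \<bar>f x\<bar> \<partial>M)"
proof (cases "integrable M f")
  case True
  then show ?thesis using integral_norm_bound_ennreal[OF True] by simp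
next
  case False
  then show ?thesis by (simp add: not_integrable_integral_eq)
qed

lemma nn_integral_lborel_translate:
  fixes g :: "'a::euclidean_space \<Rightarrow> ennreal"
  assumes [measurable]: "g \<in> borel_measurable borel"
  shows "(\<integral>\<^sup>+x. g (x - y) \<partial>lborel) = (\<integral>\<^sup>+x. g x \<partial>lborel)"
proof -
  have "(\<integral>\<^sup>+x. g x \<partial>lborel) = (\<integral>\<^sup>+x. g x \<partial>distr lborel borel (\<lambda>x. - y + x))"
    by (simp only: lborel_distr_plus)
  also have "\<dots> = (\<integral>\<^sup>+x. g (x - y) \<partial>lborel)"
    by (subst nn_integral_distr) (simp_all add: algebra_simps)
  finally show ?thesis by simp
qed

lemma nn_integral_lborel_reflect:
  fixes g :: "'a::euclidean_space \<Rightarrow> ennreal"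
  assumes [measurable]: "g \<in> borel_measurable borel"
  shows "(\<integral>\<^sup>+y. g (x - y) \<partial>lborel) = (\<integral>\<^sup>+y. g y \<partial>lborel)"
proof -
  have reflect: "(lborel :: 'a measure) = distr lborel borel (\<lambda>y. x - y)"
    using lborel_affine[of "-1" x] by (simp add: density_1)
  have "(\<integral>\<^sup>+y. g y \<partial>lborel) = (\<integral>\<^sup>+y. g y \<partial>distr lborel borel (\<lambda>y. x - y))"
    by (simp only: reflect[symmetric])
  also have "\<dots> = (\<integral>\<^sup>+y. g (x - y) \<partial>lborel)"
    by (subst nn_integral_distr) simp_all
  finally show ?thesis by simp
qed

text \<open>The case of Young's inequality \<open>\<parallel>K * w\<parallel>\<^sub>2 \<le> \<parallel>K\<parallel>\<^sub>1 \<parallel>w\<parallel>\<^sub>2\<close> that is needed, tested against \<open>w\<close> itself: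
\<open>2 |w x| |w y| \<le> (w x)\<^sup>2 + (w y)\<^sup>2\<close> splits the double integral into two parts, and in
each of them the kernel can be integrated out by translation invariance.\<close>

lemma Schur_test_convolution:
  fixes K w :: "'a::euclidean_space \<Rightarrow> real"
  assumes K: "integrable lborel K" and w: "L2_on UNIV w"
  shows "\<bar>L2_inner UNIV w (convolution K w)\<bar> \<le> (LINT x|lborel. \<bar>K x\<bar>) * L2_inner UNIV w w"
proof -
  have Km[measurable]: "K \<in> borel_measurable borel"
    using borel_measurable_integrable[OF K] by simp
  have wm[measurable]: "w \<in> borel_measurable borel" and w2: "integrable lborel (\<lambda>x. (w x)\<^sup>2)"
    using w by (auto simp: L2_on_UNIV)
  define N where "N = (LINT x|lborel. \<bar>K x\<bar>)"
  define W where "W = (LINT x|lborel. (w x)\<^sup>2)"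
  have N: "(\<integral>\<^sup>+x. ennreal \<bar>K x\<bar> \<partial>lborel) = ennreal N"
    unfolding N_def using K by (intro nn_integral_eq_integral) auto
  have W: "(\<integral>\<^sup>+x. ennreal ((w x)\<^sup>2) \<partial>lborel) = ennreal W"
    unfolding W_def using w2 by (intro nn_integral_eq_integral) auto
  have N0: "0 \<le> N" and W0: "0 \<le> W" by (simp_all add: N_def W_def)
  let ?A = "\<lambda>x y. ennreal ((w x)\<^sup>2 / 2) * ennreal \<bar>K (x - y)\<bar>"
  let ?B = "\<lambda>x y. ennreal ((w y)\<^sup>2 / 2) * ennreal \<bar>K (x - y)\<bar>"
  have half: "(\<integral>\<^sup>+x. ennreal ((w x)\<^sup>2 / 2) * ennreal N \<partial>lborel) = ennreal (N * W / 2)"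
  proof -
    have "(\<integral>\<^sup>+x. ennreal ((w x)\<^sup>2 / 2) * ennreal N \<partial>lborel)
        = (\<integral>\<^sup>+x. ennreal (N / 2) * ennreal ((w x)\<^sup>2) \<partial>lborel)"
      using N0 by (intro nn_integral_cong) (simp add: ennreal_mult''[symmetric] ennreal_mult[symmetric] mult.commute)
    also have "\<dots> = ennreal (N / 2) * ennreal W"
      by (simp add: nn_integral_cmult W)
    also have "\<dots> = ennreal (N * W / 2)"
      using N0 W0 by (simp add: ennreal_mult[symmetric])
    finally show ?thesis .
  qed
  have A: "(\<integral>\<^sup>+x. \<integral>\<^sup>+y. ?A x y \<partial>lborel \<partial>lborel) = ennreal (N * W / 2)"
  proof -
    have "(\<integral>\<^sup>+y. ?A x y \<partial>lborel) = ennreal ((w x)\<^sup>2 / 2) * ennreal N" for x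
      using nn_integral_lborel_reflect[of "\<lambda>z. ennreal \<bar>K z\<bar>" x] by (simp add: nn_integral_cmult N)
    then show ?thesis using half by simp
  qed
  have B: "(\<integral>\<^sup>+x. \<integral>\<^sup>+y. ?B x y \<partial>lborel \<partial>lborel) = ennreal (N * W / 2)"
  proof -
    have "(\<integral>\<^sup>+x. \<integral>\<^sup>+y. ?B x y \<partial>lborel \<partial>lborel) = (\<integral>\<^sup>+y. \<integral>\<^sup>+x. ?B x y \<partial>lborel \<partial>lborel)"
      by (rule lborel_pair.Fubini'[symmetric]) simp
    moreover have "(\<integral>\<^sup>+x. ?B x y \<partial>lborel) = ennreal ((w y)\<^sup>2 / 2) * ennreal N" for y
      using nn_integral_lborel_translate[of "\<lambda>z. ennreal \<bar>K z\<bar>" y] by (simp add: nn_integral_cmult N)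
    ultimately show ?thesis using half by simp
  qed
  have "ennreal \<bar>L2_inner UNIV w (convolution K w)\<bar>
      \<le> (\<integral>\<^sup>+x. ennreal \<bar>w x * convolution K w x\<bar> \<partial>lborel)"
    unfolding L2_inner_UNIV by (rule ennreal_abs_integral_le)
  also have "\<dots> \<le> (\<integral>\<^sup>+x. \<integral>\<^sup>+y. ?A x y + ?B x y \<partial>lborel \<partial>lborel)"
  proof (rule nn_integral_mono)
    fix x
    have "w x * convolution K w x = (LINT y|lborel. w x * (K (x - y) * w y))"
      by (simp add: convolution_def)
    then have "ennreal \<bar>w x * convolution K w x\<bar> \<le> (\<integral>\<^sup>+y. ennreal \<bar>w x * (K (x - y) * w y)\<bar> \<partial>lborel)"
      using ennreal_abs_integral_le by metis
    also have "\<dots> \<le> (\<integral>\<^sup>+y. ?A x y + ?B x y \<partial>lborel)"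
    proof (rule nn_integral_mono)
      fix y
      have "2 * \<bar>w x\<bar> * \<bar>w y\<bar> * \<bar>K (x - y)\<bar> \<le> (\<bar>w x\<bar>\<^sup>2 + \<bar>w y\<bar>\<^sup>2) * \<bar>K (x - y)\<bar>"
        by (rule mult_right_mono[OF sum_squares_bound]) simp
      then have "\<bar>w x * (K (x - y) * w y)\<bar>
          \<le> (w x)\<^sup>2 / 2 * \<bar>K (x - y)\<bar> + (w y)\<^sup>2 / 2 * \<bar>K (x - y)\<bar>"
        by (simp add: abs_mult algebra_simps)
      then have "ennreal \<bar>w x * (K (x - y) * w y)\<bar>
          \<le> ennreal ((w x)\<^sup>2 / 2 * \<bar>K (x - y)\<bar> + (w y)\<^sup>2 / 2 * \<bar>K (x - y)\<bar>)"
        by (rule ennreal_leI)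
      also have "\<dots> = ?A x y + ?B x y"
        by (subst ennreal_plus) (simp_all only: ennreal_mult zero_le_power2 abs_ge_zero
            mult_nonneg_nonneg divide_nonneg_nonneg zero_le_numeral)
      finally show "ennreal \<bar>w x * (K (x - y) * w y)\<bar> \<le> ?A x y + ?B x y" .
    qed
    finally show "ennreal \<bar>w x * convolution K w x\<bar> \<le> (\<integral>\<^sup>+y. ?A x y + ?B x y \<partial>lborel)" .
  qed
  also have "\<dots> = (\<integral>\<^sup>+x. \<integral>\<^sup>+y. ?A x y \<partial>lborel \<partial>lborel) + (\<integral>\<^sup>+x. \<integral>\<^sup>+y. ?B x y \<partial>lborel \<partial>lborel)"
    by (subst nn_integral_add[symmetric]) (auto intro!: nn_integral_cong nn_integral_add)
  also have "\<dots> = ennreal (N * W)"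
    unfolding A B using N0 W0 by (simp flip: ennreal_plus)
  finally have "\<bar>L2_inner UNIV w (convolution K w)\<bar> \<le> N * W"
    using N0 W0 by (simp add: ennreal_le_iff)
  then show ?thesis by (simp add: N_def W_def L2_inner_UNIV power2_eq_square)
qed

locale translation_invariant_rkhs = rkhs H ip "\<lambda>x y. K (x - y)"
  for H :: "('a::euclidean_space \<Rightarrow> real) set" and ip and K :: "'a \<Rightarrow> real" +
  assumes K_continuous: "continuous_on UNIV K"
    and K_symmetric: "K (- x) = K x"
    and K_integrable: "integrable lborel K"
begin

lemma ip_kernels: "ip (\<lambda>y. K (y - x)) (\<lambda>y. K (y - z)) = K (x - z)"
  using reproducing[OF kernel_mem, of z x] K_symmetric[of "z - x"] by simp

lemma abs_mem_le:
  assumes "f \<in> H"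
  shows "\<bar>f x\<bar> \<le> sqrt (K 0) * ip_norm ip f"
  using Cauchy_Schwarz[OF assms kernel_mem, of x] reproducing[OF assms, of x]
  by (simp add: ip_norm_def[of ip "\<lambda>y. K (y - x)"] ip_kernels mult.commute)

text \<open>The kernel translate with centre \<open>x\<close> depends continuously on \<open>x\<close> in the norm of the space.\<close>

lemma mem_continuous:
  assumes f: "f \<in> H"
  shows "continuous_on UNIV f"
  unfolding continuous_on_def
proof
  fix x :: 'a
  have K: "isCont K 0"
    using K_continuous by (simp add: continuous_on_eq_continuous_within)
  have "((\<lambda>z. f z - f x) \<longlongrightarrow> 0) (at x)"
  proof (rule Lim_null_comparison)
    have "\<bar>f z - f x\<bar> \<le> ip_norm ip f * sqrt (2 * K 0 - 2 * K (z - x))" for z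
    proof -
      let ?d = "\<lambda>y. K (y - z) - K (y - x)"
      have d: "?d \<in> H" by (rule diff_mem[OF kernel_mem kernel_mem])
      have "f z - f x = ip f ?d"
        using reproducing[OF f, of z] reproducing[OF f, of x]
        by (simp add: ip_sym[OF f d] ip_diff[OF kernel_mem kernel_mem f] ip_sym[OF f kernel_mem])
      moreover have "ip ?d ?d = 2 * K 0 - 2 * K (z - x)"
        using ip_diff_self[OF kernel_mem kernel_mem, of z x] by (simp add: ip_kernels)
      ultimately show ?thesis
        using Cauchy_Schwarz[OF f d] by (simp add: ip_norm_def[of ip ?d])
    qed
    then show "\<forall>\<^sub>F z in at x. norm (f z - f x) \<le> ip_norm ip f * sqrt (2 * K 0 - 2 * K (z - x))"
      by simp
    have "((\<lambda>z. K (z - x)) \<longlongrightarrow> K 0) (at x)"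
      using K by (intro isCont_tendsto_compose[of _ K]) (auto intro!: tendsto_eq_intros)
    then have "((\<lambda>z. ip_norm ip f * sqrt (2 * K 0 - 2 * K (z - x)))
        \<longlongrightarrow> ip_norm ip f * sqrt (2 * K 0 - 2 * K 0)) (at x)"
      by (intro tendsto_intros)
    then show "((\<lambda>z. ip_norm ip f * sqrt (2 * K 0 - 2 * K (z - x))) \<longlongrightarrow> 0) (at x)"
      by simp
  qed
  then show "(f \<longlongrightarrow> f x) (at x within UNIV)" by (simp add: LIM_zero_iff)
qed

lemma mem_measurable: "f \<in> H \<Longrightarrow> f \<in> borel_measurable borel"
  by (rule borel_measurable_continuous_onI) (rule mem_continuous)

text \<open>Whenever integration against \<open>w\<close> is a bounded functional on the space, the reproducing property
identifies its Riesz representer as the convolution of \<open>K\<close> with \<open>w\<close>.\<close>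

lemma convolution_represents:
  assumes int: "\<And>g. g \<in> H \<Longrightarrow> integrable lborel (\<lambda>x. w x * g x)"
    and bd: "\<And>g. g \<in> H \<Longrightarrow> \<bar>L2_inner UNIV w g\<bar> \<le> C * ip_norm ip g"
  shows "convolution K w \<in> H \<and> (\<forall>g\<in>H. ip (convolution K w) g = L2_inner UNIV w g)"
proof -
  have "\<exists>u\<in>H. \<forall>g\<in>H. ip u g = L2_inner UNIV w g"
  proof (rule Riesz_representation[OF _ bd])
    fix f g a b assume "f \<in> H" "g \<in> H"
    then have "(LINT x|lborel. a * (w x * f x) + b * (w x * g x))
        = a * (LINT x|lborel. w x * f x) + b * (LINT x|lborel. w x * g x)"
      using int by simp
    then show "L2_inner UNIV w (\<lambda>x. a * f x + b * g x) = a * L2_inner UNIV w f + b * L2_inner UNIV w g"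
      by (simp add: L2_inner_UNIV algebra_simps)
  qed
  then obtain u where u: "u \<in> H" and rep: "\<And>g. g \<in> H \<Longrightarrow> ip u g = L2_inner UNIV w g" by blast
  have "u x = convolution K w x" for x
  proof -
    have "K (y - x) = K (x - y)" for y using K_symmetric[of "x - y"] by simp
    then show ?thesis
      using reproducing[OF u, of x] rep[OF kernel_mem, of x]
      by (simp add: L2_inner_UNIV convolution_def mult.commute)
  qed
  then have "u = convolution K w" by (rule ext)
  then show ?thesis using u rep by blast
qed

text \<open>Let \<open>w\<close> be \<open>f\<close> cut off outside the ball. The \<open>L\<^sub>2\<close> mass \<open>I\<close> of \<open>w\<close> is the inner product of
\<open>f\<close> with \<open>u = K * w\<close>, and Schur's test bounds \<open>(u, u)\<close> by \<open>\<parallel>K\<parallel>\<^sub>1 I\<close>. Hence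
\<open>I\<^sup>2 \<le> \<parallel>K\<parallel>\<^sub>1 I (f, f)\<close>, where one factor \<open>I\<close> cancels.\<close>

lemma L2_mass_on_cball_le:
  assumes f: "f \<in> H"
  shows "(LINT x|lborel. indicator (cball 0 r) x * (f x)\<^sup>2) \<le> (LINT x|lborel. \<bar>K x\<bar>) * ip f f"
proof -
  define w where "w x = indicator (cball 0 r) x * f x" for x
  define N where "N = (LINT x|lborel. \<bar>K x\<bar>)"
  define I where "I = L2_inner UNIV w w"
  have ww: "w x * w x = w x * f x" for x by (simp add: w_def indicator_def)
  have local_int: "integrable lborel (\<lambda>x. w x * g x)" if "g \<in> H" for g
  proof -
    have "integrable lborel (\<lambda>x. indicator (cball 0 r) x *\<^sub>R (f x * g x))"
      by (intro borel_integrable_compact compact_cball continuous_intros)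
        (auto intro: continuous_on_subset[OF mem_continuous] f that)
    then show ?thesis by (simp add: w_def mult.assoc)
  qed
  have w: "L2_on UNIV w"
    using local_int[OF f] mem_measurable[OF f]
    by (auto simp: L2_on_UNIV power2_eq_square ww)
       (auto simp: w_def[abs_def] intro!: borel_measurable_times borel_measurable_indicator)
  have abs_int: "integrable lborel (\<lambda>x. \<bar>w x\<bar>)"
  proof -
    have "integrable lborel (\<lambda>x. indicator (cball 0 r) x *\<^sub>R \<bar>f x\<bar>)"
      by (intro borel_integrable_compact compact_cball continuous_intros)
        (auto intro: continuous_on_subset[OF mem_continuous] f)
    then show ?thesis by (simp add: w_def abs_mult)
  qed
  have bd: "\<bar>L2_inner UNIV w g\<bar> \<le> ((LINT x|lborel. \<bar>w x\<bar>) * sqrt (K 0)) * ip_norm ip g"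
    if g: "g \<in> H" for g
  proof -
    have "\<bar>L2_inner UNIV w g\<bar> \<le> (LINT x|lborel. \<bar>w x * g x\<bar>)"
      unfolding L2_inner_UNIV by (rule integral_abs_bound)
    also have "\<dots> \<le> (LINT x|lborel. \<bar>w x\<bar> * (sqrt (K 0) * ip_norm ip g))"
      using integrable_abs[OF local_int[OF g]] abs_int abs_mem_le[OF g]
      by (intro integral_mono) (auto simp: abs_mult intro!: mult_left_mono)
    also have "\<dots> = ((LINT x|lborel. \<bar>w x\<bar>) * sqrt (K 0)) * ip_norm ip g"
      by (simp add: mult.assoc)
    finally show ?thesis .
  qed
  define u where "u = convolution K w"
  have u: "u \<in> H" and rep: "\<And>g. g \<in> H \<Longrightarrow> ip u g = L2_inner UNIV w g"
    using convolution_represents[OF local_int bd] by (auto simp: u_def)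
  have I: "I = ip u f" by (simp add: rep[OF f] I_def L2_inner_UNIV ww)
  have "ip u u \<le> N * I"
    using Schur_test_convolution[OF K_integrable w] by (simp add: rep[OF u] I_def N_def flip: u_def)
  have I0: "0 \<le> I" by (simp add: I_def L2_inner_self_nonneg)
  have "I\<^sup>2 \<le> ip u u * ip f f"
    using power_mono[OF Cauchy_Schwarz[OF u f], of 2] ip_norm_power2[OF u] ip_norm_power2[OF f]
    by (simp add: I power_mult_distrib)
  also have "\<dots> \<le> (N * I) * ip f f"
    by (rule mult_right_mono[OF \<open>ip u u \<le> N * I\<close> ip_self_nonneg[OF f]])
  finally have "I * I \<le> I * (N * ip f f)" by (simp add: power2_eq_square ac_simps)
  moreover have "0 \<le> N * ip f f" using ip_self_nonneg[OF f] by (simp add: N_def)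
  ultimately have "I \<le> N * ip f f" using I0 by (cases "I = 0") auto
  moreover have "I = (LINT x|lborel. indicator (cball 0 r) x * (f x)\<^sup>2)"
    by (simp add: I_def L2_inner_UNIV ww) (simp add: w_def power2_eq_square mult.assoc)
  ultimately show ?thesis by (simp add: N_def)
qed

text \<open>The embedding of the native space into \<open>L\<^sub>2\<close> with norm at most \<open>sqrt \<parallel>K\<parallel>\<^sub>1\<close>. On the Fourier side
this is the boundedness of the Fourier transform of \<open>K\<close>; here it follows from the
estimate on balls, uniform in the radius, by monotone convergence.\<close>

lemma mem_L2_bound:
  assumes f: "f \<in> H"
  shows "L2_on UNIV f \<and> L2_inner UNIV f f \<le> (LINT x|lborel. \<bar>K x\<bar>) * ip f f"
proof -
  note [measurable] = mem_measurable[OF f]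
  define C where "C = (LINT x|lborel. \<bar>K x\<bar>) * ip f f"
  have C0: "0 \<le> C" using ip_self_nonneg[OF f] by (simp add: C_def)
  have le: "(\<integral>\<^sup>+x. ennreal ((f x)\<^sup>2) \<partial>lborel) \<le> ennreal C"
  proof -
    let ?f = "\<lambda>n x. ennreal (indicator (cball 0 (real n)) x * (f x)\<^sup>2)"
    have sup: "(SUP n. ?f n x) = ennreal ((f x)\<^sup>2)" for x
    proof (rule antisym)
      show "(SUP n. ?f n x) \<le> ennreal ((f x)\<^sup>2)"
        by (rule SUP_least) (auto simp: indicator_def intro: ennreal_leI)
      obtain n where "norm x \<le> real n" using real_arch_simple by blast
      then have "ennreal ((f x)\<^sup>2) = ?f n x" by simp
      also have "\<dots> \<le> (SUP n. ?f n x)" by (rule SUP_upper) simp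
      finally show "ennreal ((f x)\<^sup>2) \<le> (SUP n. ?f n x)" .
    qed
    have "incseq ?f"
      by (auto simp: incseq_def le_fun_def indicator_def intro!: ennreal_leI)
    then have "(\<integral>\<^sup>+x. (SUP n. ?f n x) \<partial>lborel) = (SUP n. \<integral>\<^sup>+x. ?f n x \<partial>lborel)"
      by (rule nn_integral_monotone_convergence_SUP)
        (auto intro!: measurable_compose[OF _ measurable_ennreal] borel_measurable_times
          borel_measurable_indicator borel_measurable_power mem_measurable[OF f])
    also have "\<dots> \<le> ennreal C"
    proof (rule SUP_least)
      fix n
      have "integrable lborel (\<lambda>x. indicator (cball 0 (real n)) x *\<^sub>R (f x)\<^sup>2)"
        by (intro borel_integrable_compact compact_cball continuous_intros
            continuous_on_subset[OF mem_continuous[OF f]]) simp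
      then have "(\<integral>\<^sup>+x. ?f n x \<partial>lborel) = ennreal (LINT x|lborel. indicator (cball 0 (real n)) x * (f x)\<^sup>2)"
        by (intro nn_integral_eq_integral) auto
      also have "\<dots> \<le> ennreal C"
        unfolding C_def by (intro ennreal_leI L2_mass_on_cball_le f)
      finally show "(\<integral>\<^sup>+x. ?f n x \<partial>lborel) \<le> ennreal C" .
    qed
    finally show ?thesis by (simp add: sup)
  qed
  have int: "integrable lborel (\<lambda>x. (f x)\<^sup>2)"
  proof (rule integrableI_bounded)
    show "(\<integral>\<^sup>+x. ennreal (norm ((f x)\<^sup>2)) \<partial>lborel) < \<infinity>"
      using le by (simp add: less_top[symmetric] top_unique) (metis ennreal_neq_top top_unique)
  qed simp
  then have "ennreal (LINT x|lborel. (f x)\<^sup>2) \<le> ennreal C"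
    using le by (simp add: nn_integral_eq_integral)
  then have "(LINT x|lborel. (f x)\<^sup>2) \<le> C" using C0 by (simp add: ennreal_le_iff)
  then show ?thesis
    using int by (simp add: L2_on_UNIV L2_inner_UNIV C_def power2_eq_square)
qed

text \<open>Convolution with \<open>K\<close> is the adjoint of the embedding into \<open>L\<^sub>2\<close>.\<close>

lemma convolution_L2:
  assumes v: "L2_on UNIV v"
  shows convolution_L2_mem: "convolution K v \<in> H"
    and ip_convolution_L2: "g \<in> H \<Longrightarrow> ip (convolution K v) g = L2_inner UNIV v g"
proof -
  have "\<bar>L2_inner UNIV v g\<bar> \<le> (L2_norm UNIV v * sqrt (LINT x|lborel. \<bar>K x\<bar>)) * ip_norm ip g"
    if g: "g \<in> H" for g
  proof -
    have "L2_norm UNIV g \<le> sqrt (LINT x|lborel. \<bar>K x\<bar>) * ip_norm ip g"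
      using mem_L2_bound[OF g] by (simp add: L2_norm_def ip_norm_def real_sqrt_mult[symmetric])
    then have "L2_norm UNIV v * L2_norm UNIV g
        \<le> L2_norm UNIV v * (sqrt (LINT x|lborel. \<bar>K x\<bar>) * ip_norm ip g)"
      by (rule mult_left_mono) (simp add: L2_norm_def L2_inner_self_nonneg)
    then show ?thesis
      using L2_Cauchy_Schwarz[OF v, of g] mem_L2_bound[OF g] by (simp add: mult.assoc)
  qed
  with v mem_L2_bound have "convolution K v \<in> H \<and> (\<forall>g\<in>H. ip (convolution K v) g = L2_inner UNIV v g)"
    by (intro convolution_represents) (auto intro: L2_integrable_mult)
  then show "convolution K v \<in> H" "g \<in> H \<Longrightarrow> ip (convolution K v) g = L2_inner UNIV v g" by auto
qed

end

section \<open>Mercer eigenfunctions in the reproducing kernel Hilbert space\<close>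

locale mercer_native_space = translation_invariant_rkhs H ip K
  for H :: "('a::euclidean_space \<Rightarrow> real) set" and ip and K +
  fixes \<Omega> :: "'a set" and \<kappa> :: "nat \<Rightarrow> real" and \<phi> :: "nat \<Rightarrow> 'a \<Rightarrow> real"
  assumes open_domain: "open \<Omega>"
    and mercer: "mercer_expansion K \<Omega> \<kappa> \<phi>"
begin

abbreviation "E \<equiv> eigensystem_ext K \<Omega> \<kappa> \<phi>"
abbreviation "ext_E \<equiv> eigenfunction_ext K \<Omega> \<kappa> \<phi>"
abbreviation "fourier f n \<equiv> L2_inner \<Omega> f (\<phi> n)"

lemma eigenvalue_pos: "\<kappa> n > 0"
  using mercer by (simp add: mercer_expansion_def)

lemma eigenfunction_L2: "L2_on \<Omega> (\<phi> n)"
  using mercer by (simp add: mercer_expansion_def complete_orthonormal_system_def)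

lemma mem_L2_domain: "f \<in> H \<Longrightarrow> L2_on \<Omega> f"
  using mem_L2_bound open_domain by (auto intro: L2_on_UNIV_imp)

text \<open>Cutting \<open>\<phi> n\<close> off outside the domain exhibits its extension as the convolution of \<open>K\<close> with a
square integrable function on the whole space, which makes the adjointness relation for
convolutions applicable.\<close>

lemma ext_eigenfunction_eq:
  "E n = (\<lambda>x. inverse (\<kappa> n) * convolution K (\<lambda>y. indicator \<Omega> y * \<phi> n y) x)"
  by (simp add: eigensystem_ext_def convolution_def set_lebesgue_integral_def fun_eq_iff ac_simps)

lemma ext_eigenfunction_mem: "E n \<in> H"
  unfolding ext_eigenfunction_eq using eigenfunction_L2[of n]
  by (intro scale_mem convolution_L2_mem) (simp_all add: L2_on_zero_extension[of \<Omega>])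

lemma ip_ext_eigenfunction:
  assumes g: "g \<in> H"
  shows "ip (E n) g = fourier g n / \<kappa> n"
proof -
  have v: "L2_on UNIV (\<lambda>y. indicator \<Omega> y * \<phi> n y)"
    using eigenfunction_L2[of n] by (simp add: L2_on_zero_extension[of \<Omega>])
  show ?thesis
    unfolding ext_eigenfunction_eq
      ip_scale[OF convolution_L2_mem[OF v] g] ip_convolution_L2[OF v g]
    by (simp add: L2_inner_sym[of \<Omega> g] L2_inner_zero_extension[of \<Omega> "\<phi> n"] field_simps)
qed

lemma ext_eigenfunction_on_domain: "x \<in> \<Omega> \<Longrightarrow> E n x = \<phi> n x"
proof -
  assume x: "x \<in> \<Omega>"
  then have "(LINT y:\<Omega>|lborel. K (x - y) * \<phi> n y) = \<kappa> n * \<phi> n x"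
    using mercer by (simp add: mercer_expansion_def)
  then show "E n x = \<phi> n x"
    using eigenvalue_pos[of n] by (simp add: eigensystem_ext_def)
qed

lemma ext_eigenfunctions_orthogonal: "ip (E m) (E n) = (if m = n then 1 / \<kappa> n else 0)"
proof -
  have "fourier (E n) m = L2_inner \<Omega> (\<phi> n) (\<phi> m)"
    by (rule L2_inner_cong) (simp_all add: ext_eigenfunction_on_domain)
  also have "\<dots> = (if m = n then 1 else 0)"
    using mercer by (simp add: mercer_expansion_def complete_orthonormal_system_def)
  finally show ?thesis by (simp add: ip_ext_eigenfunction[OF ext_eigenfunction_mem])
qed

lemma eigenfunction_ext_series:
  assumes c: "summable (\<lambda>n. (fourier f n)\<^sup>2 / \<kappa> n)"
  shows eigenfunction_ext_mem: "ext_E f \<in> H"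
    and ip_eigenfunction_ext: "g \<in> H \<Longrightarrow> (\<lambda>n. fourier f n * ip (E n) g) sums ip (ext_E f) g"
    and eigenfunction_ext_sums: "(\<lambda>n. fourier f n * E n x) sums ext_E f x"
proof -
  obtain F where F: "F \<in> H" and series: "\<And>g. g \<in> H \<Longrightarrow> (\<lambda>n. fourier f n * ip (E n) g) sums ip F g"
    using orthogonal_series[OF ext_eigenfunction_mem eigenvalue_pos ext_eigenfunctions_orthogonal c]
    by blast
  have pointwise: "(\<lambda>n. fourier f n * E n x) sums F x" for x
    using series[OF kernel_mem, of x]
    by (simp add: reproducing[OF F, symmetric] reproducing[OF ext_eigenfunction_mem, symmetric])
  have "F = ext_E f"
    using pointwise by (auto simp: eigenfunction_ext_def sums_iff)
  then show "ext_E f \<in> H" "g \<in> H \<Longrightarrow> (\<lambda>n. fourier f n * ip (E n) g) sums ip (ext_E f) g"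
    "(\<lambda>n. fourier f n * E n x) sums ext_E f x"
    using F series pointwise by auto
qed

lemma fourier_eigenfunction_ext:
  assumes c: "summable (\<lambda>n. (fourier f n)\<^sup>2 / \<kappa> n)"
  shows "fourier (ext_E f) n = fourier f n"
proof -
  have "(\<lambda>m. fourier f m * ip (E m) (E n)) sums ip (ext_E f) (E n)"
    by (rule ip_eigenfunction_ext[OF c ext_eigenfunction_mem])
  moreover have "(\<lambda>m. fourier f m * ip (E m) (E n)) sums (fourier f n / \<kappa> n)"
    using sums_single[of n "\<lambda>m. fourier f m / \<kappa> m"]
    by (simp add: ext_eigenfunctions_orthogonal if_distrib cong: if_cong)
  ultimately have "ip (ext_E f) (E n) = fourier f n / \<kappa> n" by (rule sums_unique2)
  then have "fourier (ext_E f) n / \<kappa> n = fourier f n / \<kappa> n"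
    by (simp add: ip_ext_eigenfunction[OF eigenfunction_ext_mem[OF c], symmetric]
        ip_sym[OF ext_eigenfunction_mem eigenfunction_ext_mem[OF c]])
  then show ?thesis using eigenvalue_pos[of n] by simp
qed

text \<open>A function that vanishes on the domain has zero Fourier coefficients there, hence is orthogonal
to every extended eigenfunction.\<close>

lemma eigenfunction_ext_localized:
  assumes c: "summable (\<lambda>n. (fourier f n)\<^sup>2 / \<kappa> n)"
  shows "ext_E f \<in> localized_space H ip \<Omega>"
proof -
  have "ip (ext_E f) g = 0" if "g \<in> vanishing_on H \<Omega>" for g
  proof -
    have g: "g \<in> H" and g0: "\<And>x. x \<in> \<Omega> \<Longrightarrow> g x = 0" using that by (auto simp: vanishing_on_def)
    have "fourier g n = L2_inner \<Omega> (\<lambda>x. 0) (\<phi> n)" for n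
      by (rule L2_inner_cong) (simp_all add: g0)
    then have "ip (E n) g = 0" for n
      by (simp add: ip_ext_eigenfunction[OF g] L2_inner_def set_lebesgue_integral_def)
    then show ?thesis
      using ip_eigenfunction_ext[OF c g] by (simp add: sums_iff)
  qed
  then show ?thesis by (simp add: localized_space_def eigenfunction_ext_mem[OF c])
qed

lemma mem_fourier_summable:
  assumes h: "h \<in> H"
  shows "summable (\<lambda>n. (fourier h n)\<^sup>2 / \<kappa> n)"
proof -
  have "\<kappa> n * (ip (E n) h)\<^sup>2 = (fourier h n)\<^sup>2 / \<kappa> n" for n
    using eigenvalue_pos[of n] by (simp add: ip_ext_eigenfunction[OF h] power2_eq_square)
  then show ?thesis
    using Bessel[OF ext_eigenfunction_mem eigenvalue_pos ext_eigenfunctions_orthogonal h] by simp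
qed

lemma vanishing_localized_eq_0:
  assumes "f \<in> vanishing_on H \<Omega>" "f \<in> localized_space H ip \<Omega>"
  shows "f = (\<lambda>x. 0)"
  using assms ip_self_eq_0[of f] by (auto simp: localized_space_def)

lemma localized_lincomb:
  assumes "f \<in> localized_space H ip \<Omega>" "g \<in> localized_space H ip \<Omega>"
  shows "(\<lambda>x. a * f x + b * g x) \<in> localized_space H ip \<Omega>"
  using assms by (auto simp: localized_space_def ip_linear lincomb_mem vanishing_on_def)

text \<open>The difference \<open>h - ext_E h\<close> has zero Fourier coefficients, so it vanishes almost everywhere on
the domain by completeness of the eigenfunctions, and everywhere there by continuity. Being
localized as well, it is orthogonal to itself.\<close>

lemma eigenfunction_ext_of_localized:
  assumes h: "h \<in> localized_space H ip \<Omega>"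
  shows "ext_E h = h"
proof -
  have hH: "h \<in> H" using h by (simp add: localized_space_def)
  note c = mem_fourier_summable[OF hH]
  note eH = eigenfunction_ext_mem[OF c]
  let ?d = "\<lambda>x. h x - ext_E h x"
  have dH: "?d \<in> H" using hH eH by (rule diff_mem)
  have "fourier ?d n = 0" for n
    using L2_inner_lincomb[OF mem_L2_domain[OF hH] mem_L2_domain[OF eH] eigenfunction_L2, of 1 "-1" n]
    by (simp add: fourier_eigenfunction_ext[OF c])
  then have "AE x in lborel. x \<in> \<Omega> \<longrightarrow> ?d x = 0"
    using mercer mem_L2_domain[OF dH]
    unfolding mercer_expansion_def complete_orthonormal_system_def by blast
  then have "?d \<in> vanishing_on H \<Omega>"
    using continuous_AE_zero_on_open[OF mem_continuous[OF dH] open_domain] dH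
    by (auto simp: vanishing_on_def)
  then have "?d = (\<lambda>x. 0)"
    using localized_lincomb[OF h eigenfunction_ext_localized[OF c], of 1 "-1"]
    by (simp add: vanishing_localized_eq_0)
  then show ?thesis by (auto simp: fun_eq_iff)
qed

lemma fourier_restrict: "fourier (restrict f \<Omega>) n = fourier f n"
  by (rule L2_inner_cong) simp_all

lemma eigenfunction_ext_restrict: "ext_E (restrict f \<Omega>) = ext_E f"
  by (simp add: eigenfunction_ext_def fourier_restrict fun_eq_iff)

lemma native_fourier_summable: "f \<in> native_space \<Omega> \<kappa> \<phi> \<Longrightarrow> summable (\<lambda>n. (fourier f n)\<^sup>2 / \<kappa> n)"
  by (simp add: native_space_def)

lemma eigenfunction_ext_on_domain:
  assumes f: "f \<in> native_space \<Omega> \<kappa> \<phi>" and x: "x \<in> \<Omega>"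
  shows "ext_E f x = f x"
proof (rule sums_unique2)
  show "(\<lambda>n. fourier f n * \<phi> n x) sums ext_E f x"
    using eigenfunction_ext_sums[OF native_fourier_summable[OF f], of x]
    by (simp add: ext_eigenfunction_on_domain[OF x])
  show "(\<lambda>n. fourier f n * \<phi> n x) sums f x"
    using f x by (simp add: native_space_def)
qed

lemma restrict_eigenfunction_ext:
  assumes "f \<in> native_space \<Omega> \<kappa> \<phi>"
  shows "restrict (ext_E f) \<Omega> = f"
proof (rule extensionalityI)
  show "restrict (ext_E f) \<Omega> \<in> extensional \<Omega>" by simp
  show "f \<in> extensional \<Omega>" using assms by (simp add: native_space_def)
qed (simp add: eigenfunction_ext_on_domain[OF assms])

lemma restrict_localized_native:
  assumes h: "h \<in> localized_space H ip \<Omega>"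
  shows "restrict h \<Omega> \<in> native_space \<Omega> \<kappa> \<phi>"
proof -
  have hH: "h \<in> H" using h by (simp add: localized_space_def)
  note c = mem_fourier_summable[OF hH]
  have "(\<lambda>n. fourier h n * \<phi> n x) sums h x" if "x \<in> \<Omega>" for x
    using eigenfunction_ext_sums[OF c, of x]
    by (simp add: ext_eigenfunction_on_domain[OF that] eigenfunction_ext_of_localized[OF h])
  moreover have "L2_on \<Omega> (restrict h \<Omega>)"
    using mem_L2_domain[OF hH] by (subst L2_on_cong[of _ _ h]) simp_all
  ultimately show ?thesis using c by (simp add: native_space_def fourier_restrict)
qed

lemma native_localized:
  "f \<in> native_space \<Omega> \<kappa> \<phi> \<Longrightarrow> ext_E f \<in> localized_space H ip \<Omega>"
  by (intro eigenfunction_ext_localized native_fourier_summable)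

text \<open>Linearity is inherited from the inverse: the combination of the two extensions is localized, hence
is the extension of its own restriction.\<close>

lemma native_lincomb:
  assumes f: "f \<in> native_space \<Omega> \<kappa> \<phi>" and g: "g \<in> native_space \<Omega> \<kappa> \<phi>"
  shows "(\<lambda>x\<in>\<Omega>. a * f x + b * g x) \<in> native_space \<Omega> \<kappa> \<phi> \<and>
    ext_E (\<lambda>x\<in>\<Omega>. a * f x + b * g x) = (\<lambda>x. a * ext_E f x + b * ext_E g x)"
proof -
  let ?F = "\<lambda>x. a * ext_E f x + b * ext_E g x"
  have F: "?F \<in> localized_space H ip \<Omega>"
    by (intro localized_lincomb native_localized f g)
  have eq: "(\<lambda>x\<in>\<Omega>. a * f x + b * g x) = restrict ?F \<Omega>"
    by (auto simp: eigenfunction_ext_on_domain[OF f] eigenfunction_ext_on_domain[OF g] restrict_def)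
  show ?thesis
    unfolding eq eigenfunction_ext_restrict eigenfunction_ext_of_localized[OF F]
    using restrict_localized_native[OF F] by simp
qed

lemma eigenfunction_ext_isometry:
  assumes f: "f \<in> native_space \<Omega> \<kappa> \<phi>" and g: "g \<in> native_space \<Omega> \<kappa> \<phi>"
  shows "ip (ext_E f) (ext_E g) = native_ip \<Omega> \<kappa> \<phi> f g"
proof -
  note gH = eigenfunction_ext_mem[OF native_fourier_summable[OF g]]
  have "(\<lambda>n. fourier f n * fourier g n / \<kappa> n) sums ip (ext_E f) (ext_E g)"
    using ip_eigenfunction_ext[OF native_fourier_summable[OF f] gH]
    by (simp add: ip_ext_eigenfunction[OF gH] fourier_eigenfunction_ext[OF native_fourier_summable[OF g]])
  then show ?thesis by (simp add: native_ip_def sums_iff)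
qed

lemma eigenfunction_ext_bij:
  "bij_betw ext_E (native_space \<Omega> \<kappa> \<phi>) (localized_space H ip \<Omega>)"
proof (rule bij_betw_byWitness)
  show "\<forall>f\<in>native_space \<Omega> \<kappa> \<phi>. restrict (ext_E f) \<Omega> = f"
    by (simp add: restrict_eigenfunction_ext)
  show "\<forall>h\<in>localized_space H ip \<Omega>. ext_E (restrict h \<Omega>) = h"
    by (simp add: eigenfunction_ext_restrict eigenfunction_ext_of_localized)
  show "ext_E ` native_space \<Omega> \<kappa> \<phi> \<subseteq> localized_space H ip \<Omega>"
    using native_localized by blast
  show "(\<lambda>h. restrict h \<Omega>) ` localized_space H ip \<Omega> \<subseteq> native_space \<Omega> \<kappa> \<phi>"
    using restrict_localized_native by blast
qed

text \<open>Two extensions of \<open>f\<close> in \<open>H\<close> differ by a function that vanishes on the domain, to which the localized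
function \<open>ext_E f\<close> is orthogonal; the claim is Pythagoras' theorem.\<close>

lemma eigenfunction_ext_minimal:
  assumes f: "f \<in> native_space \<Omega> \<kappa> \<phi>"
  shows "is_arg_min (ip_norm ip) (\<lambda>g. g \<in> H \<and> (\<forall>x\<in>\<Omega>. g x = f x)) h \<longleftrightarrow> h = ext_E f"
proof -
  define F where "F = ext_E f"
  have F: "F \<in> H" and orth: "\<And>g. g \<in> vanishing_on H \<Omega> \<Longrightarrow> ip F g = 0"
    using native_localized[OF f] by (auto simp: F_def localized_space_def)
  have FO: "\<forall>x\<in>\<Omega>. F x = f x" by (simp add: F_def eigenfunction_ext_on_domain[OF f])
  have less: "ip_norm ip F < ip_norm ip g"
    if g: "g \<in> H" and gO: "\<forall>x\<in>\<Omega>. g x = f x" and ne: "g \<noteq> F" for g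
  proof -
    let ?d = "\<lambda>x. g x - F x"
    have d: "?d \<in> H" using g F by (rule diff_mem)
    have "?d \<in> vanishing_on H \<Omega>" using d gO FO by (simp add: vanishing_on_def)
    then have "ip F ?d = 0" by (rule orth)
    then have "ip g g = ip F F + ip ?d ?d"
      using ip_add_scaled_self[OF F d, of 1] by simp
    moreover have "ip ?d ?d > 0" using ne by (intro ip_pos d) (auto simp: fun_eq_iff)
    ultimately show ?thesis by (simp add: ip_norm_def)
  qed
  show ?thesis
    unfolding is_arg_min_def F_def[symmetric] using F FO less by (metis less_asym less_irrefl)
qed

end

section \<open>Superconvergence\<close>

context translation_invariant_rkhs
begin

text \<open>For \<open>g\<close> vanishing on \<open>S\<close>, localization means \<open>0 = (K * v, g) = \<integral> v g\<close>. As such \<open>g\<close>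
approximate the part \<open>h\<close> of \<open>v\<close> outside \<open>S\<close>, \<open>v\<close> is orthogonal to \<open>h\<close>, that is, \<open>h\<close> is zero.\<close>

lemma localized_convolution_density_zero:
  assumes S: "S \<in> sets borel" and v: "L2_on UNIV v"
    and loc: "convolution K v \<in> localized_space H ip S"
    and sep: "separates_complement H S"
  shows "AE x in lborel. x \<notin> S \<longrightarrow> v x = 0"
proof -
  define h where "h x = indicator (- S) x * v x" for x
  have h: "L2_on UNIV h"
    using L2_on_UNIV_imp[OF v borel_comp[OF S]] by (simp add: L2_on_zero_extension[of "- S"] h_def[abs_def])
  have vh: "L2_inner UNIV v h = L2_inner UNIV h h"
    by (auto simp: L2_inner_UNIV h_def indicator_def intro!: Bochner_Integration.integral_cong)
  have "L2_inner UNIV h h \<le> 0"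
  proof (rule field_le_epsilon)
    fix e :: real assume "0 < e"
    \<comment> \<open>The summand 1 only keeps the divisor of \<open>e\<close> positive.\<close>
    define M where "M = L2_norm UNIV v + 1"
    have vM: "0 \<le> L2_norm UNIV v" by (simp add: L2_norm_def L2_inner_self_nonneg)
    have "\<forall>x\<in>S. h x = 0" by (simp add: h_def)
    moreover have "0 < e / M" using \<open>0 < e\<close> vM by (simp add: M_def)
    ultimately obtain g where gv: "g \<in> vanishing_on H S" and g: "L2_on UNIV g"
      and close: "L2_norm UNIV (\<lambda>x. h x - g x) < e / M"
      using sep h unfolding separates_complement_def by blast
    have gH: "g \<in> H" using gv by (simp add: vanishing_on_def)
    have vg: "L2_inner UNIV v g = 0"
      using loc gv ip_convolution_L2[OF v gH] by (simp add: localized_space_def)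
    have hg: "L2_on UNIV (\<lambda>x. h x - g x)" using L2_on_UNIV_lincomb[OF h g, of 1 "-1"] by simp
    have "L2_inner UNIV h h = L2_inner UNIV v (\<lambda>x. h x - g x)"
      using L2_inner_UNIV_lincomb[OF h g v, of 1 "-1"] vg vh by (simp add: L2_inner_sym[of _ _ v])
    also have "\<dots> \<le> L2_norm UNIV v * L2_norm UNIV (\<lambda>x. h x - g x)"
      using L2_Cauchy_Schwarz[OF v hg] by simp
    also have "\<dots> \<le> M * (e / M)"
      using close vM by (intro mult_mono) (auto simp: M_def L2_norm_def L2_inner_self_nonneg)
    also have "\<dots> = e" using vM by (simp add: M_def)
    finally show "L2_inner UNIV h h \<le> 0 + e" by simp
  qed
  then have "(LINT x|lborel. (h x)\<^sup>2) = 0"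
    using L2_inner_self_nonneg[of UNIV h] by (simp add: L2_inner_UNIV power2_eq_square antisym)
  then have "AE x in lborel. (h x)\<^sup>2 = 0"
    using h by (subst (asm) integral_nonneg_eq_0_iff_AE) (auto simp: L2_on_UNIV)
  then show ?thesis by eventually_elim (auto simp: h_def indicator_def)
qed

text \<open>The duality argument of Aubin and Nitsche. The error \<open>e = f - P f\<close> is orthogonal to \<open>P f\<close>, so
\<open>(e, e) = (f, e) = \<integral> v e\<close>. Since \<open>v\<close> is concentrated on \<open>S\<close>, the integral only sees
\<open>e\<close> on \<open>S\<close> and is at most \<open>\<parallel>v\<parallel>\<^sub>2\<close> times the \<open>L\<^sub>2\<close> norm of \<open>e\<close> on \<open>S\<close>, hence at most \<open>\<epsilon> \<parallel>v\<parallel>\<^sub>2\<close> times the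
Hilbert norm of \<open>e\<close>. Cancelling that norm once and applying the error bound again
produces \<open>\<epsilon>\<^sup>2\<close>.\<close>

lemma superconvergent_localized_convolution:
  assumes S: "S \<in> sets borel" and f: "f \<in> localized_space H ip S" and sep: "separates_complement H S"
  shows "superconvergent K H ip S f"
  unfolding superconvergent_def
proof (intro allI impI, elim conjE)
  fix V P \<epsilon> v
  assume V: "closed_subspace H ip V" and P: "orthogonal_projector H ip V P"
    and bound: "\<forall>g\<in>H. L2_norm S (\<lambda>x. g x - P g x) \<le> \<epsilon> * ip_norm ip (\<lambda>x. g x - P g x)"
    and v: "L2_on UNIV v" and fv: "f = convolution K v"
  have fH: "f \<in> H" using f by (simp add: localized_space_def)
  have PV: "P f \<in> V" using P fH by (auto simp: orthogonal_projector_def)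
  then have PH: "P f \<in> H" using V by (auto simp: closed_subspace_def)
  define e where "e x = f x - P f x" for x
  have e: "e \<in> H" unfolding e_def[abs_def] using fH PH by (rule diff_mem)
  let ?n = "ip_norm ip e" and ?l = "L2_norm S e" and ?v = "L2_norm UNIV v"
  have eP: "ip e (P f) = 0"
    using P fH PV by (auto simp: orthogonal_projector_def e_def[abs_def])
  let ?eS = "\<lambda>x. indicator S x * e x"
  have eS: "L2_on UNIV ?eS"
    using L2_on_UNIV_imp[OF _ S] mem_L2_bound[OF e] by (simp add: L2_on_zero_extension[of S])
  have "ip e e = ip f e - ip (P f) e"
    using ip_diff[OF fH PH e] by (simp add: e_def[abs_def])
  also have "\<dots> = L2_inner UNIV v e"
    using eP ip_convolution_L2[OF v e, folded fv] by (simp add: ip_sym[OF PH e])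
  also have "\<dots> = L2_inner UNIV v ?eS"
    unfolding L2_inner_UNIV
  proof (rule integral_cong_AE)
    show "AE x in lborel. v x * e x = v x * (indicator S x * e x)"
      using localized_convolution_density_zero[OF S v f[unfolded fv] sep]
      by eventually_elim (auto simp: indicator_def)
  qed (use v eS mem_measurable[OF e] in \<open>auto simp: L2_on_UNIV\<close>)
  also have "\<dots> \<le> ?v * L2_norm UNIV ?eS"
    using L2_Cauchy_Schwarz[OF v eS] by simp
  also have "L2_norm UNIV ?eS = ?l"
    by (simp add: L2_norm_def L2_inner_zero_extension_both[of S])
  finally have energy: "?n\<^sup>2 \<le> ?v * ?l" by (simp add: ip_norm_power2[OF e])
  have le: "?l \<le> \<epsilon> * ?n" using bound fH by (auto simp: e_def[abs_def])
  have n0: "0 \<le> ?n" by (rule ip_norm_nonneg[OF e])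
  have l0: "0 \<le> ?l" and v0: "0 \<le> ?v" by (simp_all add: L2_norm_def L2_inner_self_nonneg)
  have "?l \<le> \<epsilon>\<^sup>2 * ?v"
  proof (cases "?n = 0")
    case True
    then have "?l \<le> 0" using le by simp
    also have "0 \<le> \<epsilon>\<^sup>2 * ?v" using v0 by simp
    finally show ?thesis .
  next
    case False
    then have n: "0 < ?n" using n0 by simp
    have "0 \<le> \<epsilon> * ?n" using l0 le by linarith
    \<comment> \<open>The sign of \<open>\<epsilon>\<close> is not part of the error bound, but a nonzero error forces it.\<close>
    then have \<epsilon>: "0 \<le> \<epsilon>" using n by (simp add: zero_le_mult_iff)
    have "?n * ?n \<le> (?v * \<epsilon>) * ?n"
      using energy mult_left_mono[OF le v0] by (simp add: power2_eq_square mult.assoc)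
    then have "?n \<le> ?v * \<epsilon>" using n by simp
    then have "\<epsilon> * ?n \<le> \<epsilon> * (?v * \<epsilon>)" using \<epsilon> by (rule mult_left_mono)
    then show ?thesis using le by (simp add: power2_eq_square ac_simps)
  qed
  then show "L2_norm S (\<lambda>x. f x - P f x) \<le> \<epsilon>\<^sup>2 * L2_norm UNIV v" by (simp add: e_def[abs_def])
qed

end

section \<open>Localized spaces and Mercer expansions\<close>

theorem theorem6:
  fixes K :: "'a::euclidean_space \<Rightarrow> real"
    and \<Omega> :: "'a set"
    and \<kappa> :: "nat \<Rightarrow> real"
    and \<phi> :: "nat \<Rightarrow> 'a \<Rightarrow> real"
    and H :: "('a \<Rightarrow> real) set"
    and ip :: "('a \<Rightarrow> real) \<Rightarrow> ('a \<Rightarrow> real) \<Rightarrow> real"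
  assumes K_continuous: "continuous_on UNIV K"
    and K_symmetric: "\<And>x. K (- x) = K x"
    and K_spd: "strictly_positive_definite K"
    and K_integrable: "integrable lborel K"
    and K_decay: "\<And>x. set_integrable lborel \<Omega> (\<lambda>y. (K (x - y))\<^sup>2)"
    and \<Omega>_domain: "open \<Omega>" "connected \<Omega>" "\<Omega> \<noteq> {}" "bounded \<Omega>"
    and mercer: "mercer_expansion K \<Omega> \<kappa> \<phi>"
    and native: "rkhs H ip (\<lambda>x y. K (x - y))"
  shows
    "(\<forall>f\<in>native_space \<Omega> \<kappa> \<phi>. \<forall>x.
        summable (\<lambda>n. L2_inner \<Omega> f (\<phi> n) * eigensystem_ext K \<Omega> \<kappa> \<phi> n x)) \<and>
     bij_betw (eigenfunction_ext K \<Omega> \<kappa> \<phi>) (native_space \<Omega> \<kappa> \<phi>) (localized_space H ip \<Omega>) \<and>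
     (\<forall>f\<in>native_space \<Omega> \<kappa> \<phi>. \<forall>g\<in>native_space \<Omega> \<kappa> \<phi>. \<forall>a b.
        (\<lambda>x\<in>\<Omega>. a * f x + b * g x) \<in> native_space \<Omega> \<kappa> \<phi> \<and>
        eigenfunction_ext K \<Omega> \<kappa> \<phi> (\<lambda>x\<in>\<Omega>. a * f x + b * g x) =
          (\<lambda>x. a * eigenfunction_ext K \<Omega> \<kappa> \<phi> f x + b * eigenfunction_ext K \<Omega> \<kappa> \<phi> g x)) \<and>
     (\<forall>f\<in>native_space \<Omega> \<kappa> \<phi>. \<forall>g\<in>native_space \<Omega> \<kappa> \<phi>.
        ip (eigenfunction_ext K \<Omega> \<kappa> \<phi> f) (eigenfunction_ext K \<Omega> \<kappa> \<phi> g) =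
          native_ip \<Omega> \<kappa> \<phi> f g) \<and>
     (\<forall>f\<in>native_space \<Omega> \<kappa> \<phi>. restrict (eigenfunction_ext K \<Omega> \<kappa> \<phi> f) \<Omega> = f) \<and>
     (\<forall>g\<in>localized_space H ip \<Omega>. restrict g \<Omega> \<in> native_space \<Omega> \<kappa> \<phi> \<and>
        eigenfunction_ext K \<Omega> \<kappa> \<phi> (restrict g \<Omega>) = g) \<and>
     (\<forall>f\<in>native_space \<Omega> \<kappa> \<phi>. \<forall>h.
        is_arg_min (ip_norm ip) (\<lambda>g. g \<in> H \<and> (\<forall>x\<in>\<Omega>. g x = f x)) h \<longleftrightarrow>
          h = eigenfunction_ext K \<Omega> \<kappa> \<phi> f) \<and>
     (separates_complement H \<Omega> \<longrightarrow>
        (\<forall>f\<in>localized_space H ip \<Omega> \<inter> conv_smooth_space K. superconvergent K H ip \<Omega> f))"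
proof -
  interpret native: rkhs H ip "\<lambda>x y. K (x - y)" by (rule native)
  interpret mercer_native_space H ip K \<Omega> \<kappa> \<phi>
    by unfold_locales (simp_all add: K_continuous K_symmetric K_integrable \<Omega>_domain mercer)
  have borel: "\<Omega> \<in> sets borel" using \<Omega>_domain by simp
  show ?thesis
  proof (intro conjI ballI allI impI)
    fix f x assume "f \<in> native_space \<Omega> \<kappa> \<phi>"
    then show "summable (\<lambda>n. fourier f n * E n x)"
      by (intro sums_summable[OF eigenfunction_ext_sums] native_fourier_summable)
  next
    fix f assume "f \<in> localized_space H ip \<Omega> \<inter> conv_smooth_space K" "separates_complement H \<Omega>"
    then show "superconvergent K H ip \<Omega> f"
      using superconvergent_localized_convolution[OF borel] by blast
  next
    fix f g a b assume "f \<in> native_space \<Omega> \<kappa> \<phi>" "g \<in> native_space \<Omega> \<kappa> \<phi>"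
    from native_lincomb[OF this]
    show "(\<lambda>x\<in>\<Omega>. a * f x + b * g x) \<in> native_space \<Omega> \<kappa> \<phi>"
      "ext_E (\<lambda>x\<in>\<Omega>. a * f x + b * g x) = (\<lambda>x. a * ext_E f x + b * ext_E g x)"
      by auto
  qed (simp_all add: eigenfunction_ext_bij eigenfunction_ext_isometry
      restrict_eigenfunction_ext restrict_localized_native eigenfunction_ext_restrict
      eigenfunction_ext_of_localized eigenfunction_ext_minimal)
qed

end
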